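(* There exist universal constants $C>0$ and $c_*>0$ such that the following holds. Let $0<\varepsilon\le 1/4$, and let $d,k,n$ be positive integers with $n\ge k^2$ and $k\ge C d^3\log\frac{d}{\varepsilon}$. Let $X_1,\dots,X_n$ be i.i.d. $d$-dimensional NSN random vectors. Then for any $z\in\mathbb{R}^d$ with $\|z\|_1\le\sqrt{k}$, with probability at least $c_*$ there exists a subset $S\subseteq[n]$ with $|S|=k$ such that $\big\|\sum_{i\in S}X_i - z\big\|_\infty\le\varepsilon$.
   Context: A $d$-dimensional random vector $Y$ follows a normally-scaled normal (NSN) distribution if $Y_i = Z\cdot Z_i$ for each $i\in[d]$, where $Z,Z_1,\dots,Z_d$ are i.i.d. standard normal random variables. $[n]=\{1,\dots,n\}$. *)

theory Defs
  imports "HOL-Probability.Probability"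
begin

definition std_normal_measure :: "real measure" where
  "std_normal_measure = density lborel std_normal_density"

text \<open>Canonical probability space carrying i.i.d. standard normals
  W (i, j) for i < n and j \<le> d.  For the i-th vector, Z = W (i, d) is the
  common scale and Z_j = W (i, j), j < d, are the coordinates.\<close>
definition nsn_space :: "nat \<Rightarrow> nat \<Rightarrow> (nat \<times> nat \<Rightarrow> real) measure" where
  "nsn_space n d = PiM ({..<n} \<times> {..d}) (\<lambda>_. std_normal_measure)"

definition nsn_vec :: "nat \<Rightarrow> (nat \<times> nat \<Rightarrow> real) \<Rightarrow> nat \<Rightarrow> nat \<Rightarrow> real" where
  "nsn_vec d \<omega> i = (\<lambda>j. \<omega> (i, d) * \<omega> (i, j))"

end

(* Condition on the scales. With probability bounded below, a positive fraction of them lies in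
   [1,2] in absolute value; arrange km of these rows, with m of order n/k, into k blocks of size m.
   The subsets considered pick one row from each block, given by a function f from blocks to rows.

   Given the scales, the sum over such a subset is a centred Gaussian vector with independent
   coordinates whose variance Q_f is between k and 4k, and (sum |z_j|)^2 <= k makes the target z
   as likely as the origin up to a constant. At least half of all f have Q_f within sqrt(18k) of
   its average q, and for these the hitting probability is comparable to the small ball
   probability p for variance q, because k >> d^2.

   The second moment method finishes the proof. If f and g agree on J blocks, then conditioning on
   the rows of f bounds the probability that both hit by e^(1+J) p times that of f: for J <= k/16 by
   the Gaussian density of the rows of g alone, and for J > k/16 because 1/p <= e^(k/16), which is
   where k >> d log(d/eps) enters. Averaged over g, the factor e^J is at most e^(2k/m), a constant
   because n >= k^2. *)
theory Submission
  imports Defs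
begin

section \<open>Products of standard normal measures\<close>

lemma prob_space_std_normal: "prob_space std_normal_measure"
  unfolding std_normal_measure_def by (rule prob_space_normal_density) simp

lemma sets_std_normal [measurable_cong, simp]: "sets std_normal_measure = sets borel"
  by (simp add: std_normal_measure_def)

lemma space_std_normal [simp]: "space std_normal_measure = UNIV"
  by (simp add: std_normal_measure_def)

abbreviation gauss_space :: "'i set \<Rightarrow> ('i \<Rightarrow> real) measure" where
  "gauss_space J \<equiv> PiM J (\<lambda>_. std_normal_measure)"

lemma prob_space_gauss: "prob_space (gauss_space J)"
  by (intro prob_space_PiM prob_space_std_normal)

lemma measurable_gauss_coord [measurable]:
  "p \<in> J \<Longrightarrow> (\<lambda>x. x p) \<in> borel_measurable (gauss_space J)"
  by (metis measurable_component_singleton measurable_cong_sets sets_std_normal)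

lemma distributed_gauss_coord:
  assumes "p \<in> J"
  shows "distributed (gauss_space J) lborel (\<lambda>x. x p) std_normal_density"
proof -
  have "distr (gauss_space J) lborel (\<lambda>x. x p) = distr (gauss_space J) std_normal_measure (\<lambda>x. x p)"
    by (rule distr_cong) auto
  also have "\<dots> = std_normal_measure"
    by (rule distr_PiM_component[OF prob_space_std_normal assms])
  finally show ?thesis
    using assms by (simp add: distributed_def std_normal_measure_def)
qed

lemma indep_vars_gauss_coord:
  "prob_space.indep_vars (gauss_space J) (\<lambda>_. borel) (\<lambda>p x. x p) J"
proof -
  interpret prob_space "gauss_space J" by (rule prob_space_gauss)
  show ?thesis
  proof (cases "J = {}")
    \<comment> \<open>The description of independence by the joint law requires a nonempty index
      set, so the empty product is treated apart.\<close>
    case True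
    show ?thesis unfolding indep_vars_def indep_sets_def by (simp add: True)
  next
    case False
    have "indep_vars (\<lambda>_. std_normal_measure) (\<lambda>p x. x p) J"
    proof (subst indep_vars_iff_distr_eq_PiM'[OF False])
      have "distr (gauss_space J) (gauss_space J) (\<lambda>x. restrict x J) = distr (gauss_space J) (gauss_space J) (\<lambda>x. x)"
        by (rule distr_cong) (auto simp: space_PiM PiE_restrict)
      also have "\<dots> = gauss_space J" by (simp add: distr_id[unfolded id_def])
      also have "\<dots> = (\<Pi>\<^sub>M i\<in>J. distr (gauss_space J) std_normal_measure (\<lambda>x. x i))"
        by (rule PiM_cong) (auto simp: distr_PiM_component[OF prob_space_std_normal])
      finally show "distr (gauss_space J) (gauss_space J) (\<lambda>x. \<lambda>i\<in>J. x i)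
        = (\<Pi>\<^sub>M i\<in>J. distr (gauss_space J) std_normal_measure (\<lambda>x. x i))" by simp
    qed auto
    then show ?thesis
      by (rule indep_vars_compose2[where Y="\<lambda>_ x. x"]) (simp add: measurable_ident_sets)
  qed
qed

section \<open>Box probabilities of weighted Gaussian sums\<close>

text \<open>Here \<open>a\<close> stands for the scales after conditioning on them. The index set
  \<open>J\<close> is a parameter because conditioning views the same event inside products over
  fewer coordinates.\<close>

definition box_event :: "(nat \<times> nat) set \<Rightarrow> (nat \<Rightarrow> real) \<Rightarrow> nat set \<Rightarrow> (nat \<Rightarrow> real) \<Rightarrow> nat \<Rightarrow> real
    \<Rightarrow> (nat \<times> nat \<Rightarrow> real) set" where
  "box_event J a R c d e =
    {x \<in> space (gauss_space J). \<forall>j<d. \<bar>(\<Sum>i\<in>R. a i * x (i, j)) - c j\<bar> \<le> e}"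

lemma sets_box_event:
  assumes "R \<times> {..<d} \<subseteq> J"
  shows "box_event J a R c d e \<in> sets (gauss_space J)"
proof -
  have "(\<lambda>x. \<Sum>i\<in>R. a i * x (i, j)) \<in> borel_measurable (gauss_space J)" if "j < d" for j
    using assms that by (intro borel_measurable_sum borel_measurable_times measurable_gauss_coord) auto
  then have "{x \<in> space (gauss_space J). \<bar>(\<Sum>i\<in>R. a i * x (i, j)) - c j\<bar> \<le> e} \<in> sets (gauss_space J)"
    if "j < d" for j
    using that
    by (intro borel_measurable_le borel_measurable_abs borel_measurable_diff borel_measurable_const)
  then have "{x \<in> space (gauss_space J). \<forall>j\<in>{..<d}. \<bar>(\<Sum>i\<in>R. a i * x (i, j)) - c j\<bar> \<le> e} \<in> sets (gauss_space J)"
    by (intro sets.sets_Collect_finite_All finite_lessThan) (simp only: lessThan_iff)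
  then show ?thesis by (simp only: box_event_def Ball_def lessThan_iff)
qed

text \<open>Scaled independent normals add their variances; nonzero weights give every summand a
  positive standard deviation and hence a density.\<close>

lemma distributed_weighted_sum:
  assumes R: "finite R" "R \<noteq> {}" and sub: "R \<times> {..<d} \<subseteq> J" and j: "j < d"
    and a: "\<And>i. i \<in> R \<Longrightarrow> a i \<noteq> 0"
  shows "distributed (gauss_space J) lborel (\<lambda>x. \<Sum>i\<in>R. a i * x (i, j))
           (normal_density 0 (sqrt (\<Sum>i\<in>R. (a i)\<^sup>2)))"
proof -
  interpret prob_space "gauss_space J" by (rule prob_space_gauss)
  \<comment> \<open>Regrouping the coordinates into the singletons \<open>{(i, j)}\<close> turns
    independence over index pairs into independence over the row index.\<close>
  have "indep_vars (\<lambda>i. PiM {(i, j)} (\<lambda>_. borel)) (\<lambda>i x. restrict (\<lambda>p. x p) {(i, j)}) R"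
    by (rule indep_vars_restrict[OF indep_vars_gauss_coord])
       (use sub j in \<open>auto simp: disjoint_family_on_def\<close>)
  then have "indep_vars (\<lambda>_. borel) (\<lambda>i x. a i * restrict x {(i, j)} (i, j)) R"
    by (rule indep_vars_compose2) (intro borel_measurable_times measurable_component_singleton; auto)
  then have 2: "indep_vars (\<lambda>_. borel) (\<lambda>i x. a i * x (i, j)) R" by simp
  have "distributed (gauss_space J) lborel (\<lambda>x. 0 + a i * x (i, j)) (normal_density (0 + a i * 0) (\<bar>a i\<bar> * 1))"
    if "i \<in> R" for i
    by (rule normal_density_affine) (use that a sub j in \<open>auto intro!: distributed_gauss_coord\<close>)
  then have 3: "distributed (gauss_space J) lborel (\<lambda>x. a i * x (i, j)) (normal_density 0 \<bar>a i\<bar>)"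
    if "i \<in> R" for i using that by simp
  from sum_indep_normal[OF R 2, of "\<lambda>i. \<bar>a i\<bar>" "\<lambda>_. 0"] 3 a
  show ?thesis by simp
qed

text \<open>The sums in different coordinates use disjoint columns of the Gaussian array, hence are
  independent, and the box probability factors.\<close>

lemma measure_box_event:
  assumes R: "finite R" "R \<noteq> {}" and sub: "R \<times> {..<d} \<subseteq> J" and d: "d > 0"
    and a: "\<And>i. i \<in> R \<Longrightarrow> a i \<noteq> 0"
  shows "measure (gauss_space J) (box_event J a R c d e) =
    (\<Prod>j<d. measure (density lborel (normal_density 0 (sqrt (\<Sum>i\<in>R. (a i)\<^sup>2)))) {c j - e..c j + e})"
proof -
  interpret prob_space "gauss_space J" by (rule prob_space_gauss)
  let ?Y = "\<lambda>j x. \<Sum>i\<in>R. a i * x (i, j)"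
  have "indep_vars (\<lambda>j. PiM (R \<times> {j}) (\<lambda>_. borel)) (\<lambda>j x. restrict (\<lambda>p. x p) (R \<times> {j})) {..<d}"
    by (rule indep_vars_restrict[OF indep_vars_gauss_coord]) (use sub in \<open>auto simp: disjoint_family_on_def\<close>)
  then have "indep_vars (\<lambda>_. borel) (\<lambda>j x. ?Y j (restrict x (R \<times> {j}))) {..<d}"
    by (rule indep_vars_compose2) (intro borel_measurable_sum borel_measurable_times measurable_component_singleton; auto)
  then have ind: "indep_vars (\<lambda>_. borel) ?Y {..<d}"
    by (rule iffD1[OF indep_vars_cong, rotated -1]) auto
  have "box_event J a R c d e = (\<Inter>j\<in>{..<d}. ?Y j -` {c j - e..c j + e} \<inter> space (gauss_space J))"
    using d unfolding box_event_def by (auto simp: abs_le_iff algebra_simps)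
  then have "prob (box_event J a R c d e) = (\<Prod>j<d. prob (?Y j -` {c j - e..c j + e} \<inter> space (gauss_space J)))"
    using d by (simp only:) (rule indep_varsD_finite[OF ind], auto)
  also have "\<dots> = (\<Prod>j<d. measure (density lborel (normal_density 0 (sqrt (\<Sum>i\<in>R. (a i)\<^sup>2)))) {c j - e..c j + e})"
  proof (rule prod.cong[OF refl])
    fix j assume "j \<in> {..<d}"
    then have D: "distributed (gauss_space J) lborel (?Y j) (normal_density 0 (sqrt (\<Sum>i\<in>R. (a i)\<^sup>2)))"
      by (intro distributed_weighted_sum[OF R sub _ a]) auto
    have "prob (?Y j -` {c j - e..c j + e} \<inter> space (gauss_space J)) = measure (distr (gauss_space J) lborel (?Y j)) {c j - e..c j + e}"
      by (rule measure_distr[OF distributed_measurable[OF D], symmetric]) simp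
    then show "prob (?Y j -` {c j - e..c j + e} \<inter> space (gauss_space J)) =
      measure (density lborel (normal_density 0 (sqrt (\<Sum>i\<in>R. (a i)\<^sup>2)))) {c j - e..c j + e}"
      unfolding distributed_distr_eq_density[OF D] .
  qed
  finally show ?thesis .
qed

text \<open>The peak of the density gives the upper bound, whatever the centre. For the lower bound,
  every point of the interval has absolute value at most \<open>\<bar>c\<bar> + e\<close>, and the
  density decreases away from 0.\<close>

lemma measure_normal_interval:
  fixes c e q :: real
  assumes q: "q > 0" and e: "e \<ge> 0"
  shows "measure (density lborel (normal_density 0 (sqrt q))) {c - e..c + e} \<le> 2 * e / sqrt (2 * pi * q)"
    and "2 * e / sqrt (2 * pi * q) * exp (- (\<bar>c\<bar> + e)\<^sup>2 / (2 * q))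
      \<le> measure (density lborel (normal_density 0 (sqrt q))) {c - e..c + e}"
proof -
  let ?M = "density lborel (normal_density 0 (sqrt q))" and ?I = "{c - e..c + e}"
  interpret prob_space ?M by (rule prob_space_normal_density) (use q in simp)
  have em: "ennreal (measure ?M ?I) = (\<integral>\<^sup>+x. ennreal (normal_density 0 (sqrt q) x) * indicator ?I x \<partial>lborel)"
    by (subst emeasure_eq_measure[symmetric], subst emeasure_density) auto
  have const: "(\<integral>\<^sup>+x. ennreal b * indicator ?I x \<partial>lborel) = ennreal (b * (2 * e))" if "b \<ge> 0" for b
    using e that by (subst nn_integral_cmult_indicator) (auto simp: ennreal_mult)
  have nd: "normal_density 0 (sqrt q) x = 1 / sqrt (2 * pi * q) * exp (- x\<^sup>2 / (2 * q))" for x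
    using q by (simp add: normal_density_def)
  have "ennreal (measure ?M ?I) \<le> (\<integral>\<^sup>+x. ennreal (1 / sqrt (2 * pi * q)) * indicator ?I x \<partial>lborel)"
    unfolding em
  proof (intro nn_integral_mono mult_right_mono ennreal_leI)
    fix x show "normal_density 0 (sqrt q) x \<le> 1 / sqrt (2 * pi * q)"
      unfolding nd using q by (intro mult_left_le) auto
  qed auto
  also have "\<dots> = ennreal (1 / sqrt (2 * pi * q) * (2 * e))" by (rule const) (use q in auto)
  finally show "measure ?M ?I \<le> 2 * e / sqrt (2 * pi * q)"
    using q e by (subst (asm) ennreal_le_iff) (auto intro!: divide_nonneg_nonneg)
  let ?b = "1 / sqrt (2 * pi * q) * exp (- (\<bar>c\<bar> + e)\<^sup>2 / (2 * q))"
  have b: "?b \<ge> 0" using q by auto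
  have "ennreal (?b * (2 * e)) = (\<integral>\<^sup>+x. ennreal ?b * indicator ?I x \<partial>lborel)" by (rule const[OF b, symmetric])
  also have "\<dots> \<le> ennreal (measure ?M ?I)" unfolding em
  proof (intro nn_integral_mono)
    fix x
    show "ennreal ?b * indicator ?I x \<le> ennreal (normal_density 0 (sqrt q) x) * indicator ?I x"
    proof (cases "x \<in> ?I")
      case True
      then have "\<bar>x\<bar> \<le> \<bar>\<bar>c\<bar> + e\<bar>" by auto
      then have "x\<^sup>2 \<le> (\<bar>c\<bar> + e)\<^sup>2" by (simp add: abs_le_square_iff)
      then have "?b \<le> normal_density 0 (sqrt q) x" unfolding nd using q
        by (intro mult_left_mono) (auto intro!: divide_right_mono)
      then show ?thesis by (intro mult_right_mono ennreal_leI) auto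
    qed auto
  qed
  finally show "2 * e / sqrt (2 * pi * q) * exp (- (\<bar>c\<bar> + e)\<^sup>2 / (2 * q)) \<le> measure ?M ?I"
    by (subst (asm) ennreal_le_iff) (auto simp: mult_ac)
qed

text \<open>The bound is uniform in the centre \<open>c\<close>, so it survives the random shift of
  the centre that conditioning produces.\<close>

lemma measure_box_event_le:
  assumes R: "finite R" "R \<noteq> {}" and sub: "R \<times> {..<d} \<subseteq> J" and d: "d > 0"
    and a: "\<And>i. i \<in> R \<Longrightarrow> a i \<noteq> 0" and e: "e \<ge> 0"
  shows "measure (gauss_space J) (box_event J a R c d e)
     \<le> (2 * e / sqrt (2 * pi * (\<Sum>i\<in>R. (a i)\<^sup>2))) ^ d"
proof -
  have q: "(\<Sum>i\<in>R. (a i)\<^sup>2) > 0" by (rule sum_pos) (use R a in auto)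
  have "measure (gauss_space J) (box_event J a R c d e) =
    (\<Prod>j<d. measure (density lborel (normal_density 0 (sqrt (\<Sum>i\<in>R. (a i)\<^sup>2)))) {c j - e..c j + e})"
    by (rule measure_box_event[OF R sub d]) (fact a)
  then show ?thesis
    using prod_mono[of "{..<d}" "\<lambda>j. measure (density lborel (normal_density 0 (sqrt (\<Sum>i\<in>R. (a i)\<^sup>2)))) {c j - e..c j + e}"
       "\<lambda>_. 2 * e / sqrt (2 * pi * (\<Sum>i\<in>R. (a i)\<^sup>2))"] measure_normal_interval(1)[OF q e]
    by simp
qed

text \<open>Multiplying the one-dimensional lower bounds collects the Gaussian exponents into one
  sum. For the targets considered later this sum is at most a constant times \<open>q\<close>, so
  only a constant factor is lost.\<close>

lemma measure_box_event_ge: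
  assumes R: "finite R" "R \<noteq> {}" and sub: "R \<times> {..<d} \<subseteq> J" and d: "d > 0"
    and a: "\<And>i. i \<in> R \<Longrightarrow> a i \<noteq> 0" and e: "e \<ge> 0"
  defines "q \<equiv> \<Sum>i\<in>R. (a i)\<^sup>2"
  shows "(2 * e / sqrt (2 * pi * q)) ^ d * exp (- (\<Sum>j<d. (\<bar>c j\<bar> + e)\<^sup>2) / (2 * q))
     \<le> measure (gauss_space J) (box_event J a R c d e)"
proof -
  have q: "q > 0" unfolding q_def by (rule sum_pos) (use R a in auto)
  have "(2 * e / sqrt (2 * pi * q)) ^ d * exp (- (\<Sum>j<d. (\<bar>c j\<bar> + e)\<^sup>2) / (2 * q))
    = (\<Prod>j<d. 2 * e / sqrt (2 * pi * q) * exp (- (\<bar>c j\<bar> + e)\<^sup>2 / (2 * q)))"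
    by (subst prod.distrib, subst exp_sum[symmetric])
       (simp_all add: sum_negf sum_divide_distrib)
  also have "\<dots> \<le> (\<Prod>j<d. measure (density lborel (normal_density 0 (sqrt q))) {c j - e..c j + e})"
    by (intro prod_mono) (use q e measure_normal_interval(2)[OF q e] in auto)
  also have "\<dots> = measure (gauss_space J) (box_event J a R c d e)"
    unfolding q_def by (rule measure_box_event[OF R sub d, symmetric]) (fact a)
  finally show ?thesis .
qed

text \<open>Conditioning on the rows in \<open>S\<close> turns the second event into a box event for the rows in
  \<open>T - S\<close> with a shifted centre, and the bound on these is uniform in the centre.\<close>

lemma measure_box_event_Int_le:
  assumes fin: "finite J" "finite S" "finite T" and ne: "T - S \<noteq> {}" 
    and sub: "S \<times> {..<d} \<subseteq> J" "T \<times> {..<d} \<subseteq> J" and d: "d > 0"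
    and a: "\<And>i. i \<in> T \<Longrightarrow> a i \<noteq> 0" and e: "e \<ge> 0"
  shows "measure (gauss_space J) (box_event J a S c d e \<inter> box_event J a T c d e)
     \<le> measure (gauss_space J) (box_event J a S c d e) *
        (2 * e / sqrt (2 * pi * (\<Sum>i\<in>T - S. (a i)\<^sup>2))) ^ d"
proof -
  interpret prob_space "gauss_space J" by (rule prob_space_gauss)
  interpret product_sigma_finite "\<lambda>_::nat \<times> nat. std_normal_measure"
    using prob_space_std_normal by (simp add: prob_space_imp_sigma_finite product_sigma_finite.intro)
  \<comment> \<open>\<open>K\<close> indexes the Gaussians of the rows in \<open>T\<close> but not
    in \<open>S\<close>; all others, including those of \<open>S\<close>, belong to \<open>L\<close>
    and get frozen.\<close>
  define K where "K = (T - S) \<times> {..<d}"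
  define L where "L = J - K"
  have JLK: "J = L \<union> K" and disj: "L \<inter> K = {}" "K \<inter> L = {}" and finLK: "finite L" "finite K"
    using sub fin by (auto simp: L_def K_def)
  have SL: "S \<times> {..<d} \<subseteq> L" and TK: "(T - S) \<times> {..<d} \<subseteq> K" using sub by (auto simp: L_def K_def)
  interpret K: prob_space "gauss_space K" by (rule prob_space_gauss)
  let ?B = "(2 * e / sqrt (2 * pi * (\<Sum>i\<in>T - S. (a i)\<^sup>2))) ^ d"
  have "(\<Sum>i\<in>T - S. (a i)\<^sup>2) \<ge> 0" by (rule sum_nonneg) simp
  then have B0: "?B \<ge> 0" using e by simp
  let ?A = "box_event J a S c d e" and ?A' = "box_event J a T c d e"
  have mS: "(\<Sum>i\<in>S. a i * merge L K (x, y) (i, j)) = (\<Sum>i\<in>S. a i * x (i, j))" if "j < d" for x y j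
    using SL that by (intro sum.cong) (auto simp: merge_def)
  \<comment> \<open>Only coordinates in \<open>L\<close> enter the event of \<open>S\<close>, so its
    section is everything or nothing.\<close>
  have pre: "(\<lambda>y. merge L K (x, y)) -` ?A \<inter> space (gauss_space K) =
     (if x \<in> box_event L a S c d e then space (gauss_space K) else {})"
    if "x \<in> space (gauss_space L)" for x
    using that mS unfolding box_event_def JLK by (auto simp: space_PiM)
  have "emeasure (gauss_space J) ?A = (\<integral>\<^sup>+x. emeasure (gauss_space K) ((\<lambda>y. merge L K (x, y)) -` ?A \<inter> space (gauss_space K)) \<partial>gauss_space L)"
    by (rule emeasure_fold_integral[OF disj(1) finLK, folded JLK]) (rule sets_box_event[OF sub(1)])
  also have "\<dots> = (\<integral>\<^sup>+x. indicator (box_event L a S c d e) x \<partial>gauss_space L)"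
    by (intro nn_integral_cong) (auto simp: pre K.emeasure_space_1 split: split_indicator)
  finally have eA: "emeasure (gauss_space J) ?A = (\<integral>\<^sup>+x. indicator (box_event L a S c d e) x \<partial>gauss_space L)" .
  have "emeasure (gauss_space J) (?A \<inter> ?A') = (\<integral>\<^sup>+x. emeasure (gauss_space K) ((\<lambda>y. merge L K (x, y)) -` (?A \<inter> ?A') \<inter> space (gauss_space K)) \<partial>gauss_space L)"
    by (rule emeasure_fold_integral[OF disj(1) finLK, folded JLK])
       (intro sets.Int sets_box_event sub)
  also have "\<dots> \<le> (\<integral>\<^sup>+x. ennreal ?B * indicator (box_event L a S c d e) x \<partial>gauss_space L)"
  proof (intro nn_integral_mono)
    fix x assume x: "x \<in> space (gauss_space L)"
    show "emeasure (gauss_space K) ((\<lambda>y. merge L K (x, y)) -` (?A \<inter> ?A') \<inter> space (gauss_space K))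
       \<le> ennreal ?B * indicator (box_event L a S c d e) x"
    proof (cases "x \<in> box_event L a S c d e")
      case False
      have "(\<lambda>y. merge L K (x, y)) -` (?A \<inter> ?A') \<inter> space (gauss_space K) \<subseteq> (\<lambda>y. merge L K (x, y)) -` ?A \<inter> space (gauss_space K)" by blast
      also have "\<dots> = {}" using pre[OF x] False by simp
      finally have z: "(\<lambda>y. merge L K (x, y)) -` (?A \<inter> ?A') \<inter> space (gauss_space K) = {}" by simp
      show ?thesis unfolding z by simp
    next
      case True
      \<comment> \<open>Once \<open>x\<close> is given, the rows shared by \<open>S\<close> and
        \<open>T\<close> contribute a fixed vector, which is absorbed into the centre.\<close>
      define c' where "c' j = c j - (\<Sum>i\<in>T \<inter> S. a i * x (i, j))" for j
      have mT: "(\<Sum>i\<in>T. a i * merge L K (x, y) (i, j)) - c j = (\<Sum>i\<in>T - S. a i * y (i, j)) - c' j" if "j < d" for y j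
      proof -
        have "(\<Sum>i\<in>T. a i * merge L K (x, y) (i, j)) = (\<Sum>i\<in>T - S. a i * merge L K (x, y) (i, j)) + (\<Sum>i\<in>T \<inter> S. a i * merge L K (x, y) (i, j))"
          using fin by (subst sum.Int_Diff[of _ _ S]) auto
        also have "(\<Sum>i\<in>T - S. a i * merge L K (x, y) (i, j)) = (\<Sum>i\<in>T - S. a i * y (i, j))"
          using that disj TK by (intro sum.cong) (auto simp: merge_def)
        also have "(\<Sum>i\<in>T \<inter> S. a i * merge L K (x, y) (i, j)) = (\<Sum>i\<in>T \<inter> S. a i * x (i, j))"
          using that SL by (intro sum.cong) (auto simp: merge_def)
        finally show ?thesis by (simp add: c'_def)
      qed
      have sub': "(\<lambda>y. merge L K (x, y)) -` (?A \<inter> ?A') \<inter> space (gauss_space K) \<subseteq> box_event K a (T - S) c' d e"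
        using mT unfolding box_event_def by auto
      have "emeasure (gauss_space K) ((\<lambda>y. merge L K (x, y)) -` (?A \<inter> ?A') \<inter> space (gauss_space K)) \<le> emeasure (gauss_space K) (box_event K a (T - S) c' d e)"
        by (intro emeasure_mono sub' sets_box_event TK)
      also have "\<dots> \<le> ennreal ?B" unfolding K.emeasure_eq_measure
        by (intro ennreal_leI measure_box_event_le[OF _ ne TK d]) (use fin a e in auto)
      finally show ?thesis using True by simp
    qed
  qed
  also have "\<dots> = ennreal ?B * emeasure (gauss_space J) ?A"
    unfolding eA by (intro nn_integral_cmult borel_measurable_indicator sets_box_event SL)
  finally have "ennreal (prob (?A \<inter> ?A')) \<le> ennreal (?B * prob ?A)"
    unfolding emeasure_eq_measure ennreal_mult[OF B0 measure_nonneg] .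
  then have "prob (?A \<inter> ?A') \<le> ?B * prob ?A"
    by (rule iffD1[OF ennreal_le_iff[OF mult_nonneg_nonneg[OF B0 measure_nonneg]]])
  then show ?thesis by (simp only: mult.commute[of ?B])
qed

section \<open>The second moment method\<close>

text \<open>With \<open>N\<close> the number of events that occur,
  \<open>(1 - N / B)\<^sup>2 \<ge> 0\<close> gives
  \<open>2 * N / B - N\<^sup>2 / B\<^sup>2 \<le> 1\<close>, and the left side vanishes off the
  union. If \<open>s\<close> is the sum of the probabilities, the second moment is at most
  \<open>B * s\<close>, so expectations leave \<open>2 * s / B - s / B\<close>.\<close>

lemma (in prob_space) second_moment_Union:
  fixes A :: "'i \<Rightarrow> 'a set"
  assumes F: "finite F" and A: "\<And>f. f \<in> F \<Longrightarrow> A f \<in> events" and B: "B > 0"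
    and V: "(\<Sum>f\<in>F. \<Sum>g\<in>F. prob (A f \<inter> A g)) \<le> B * (\<Sum>f\<in>F. prob (A f))"
  shows "(\<Sum>f\<in>F. prob (A f)) / B \<le> prob (\<Union>f\<in>F. A f)"
proof -
  let ?s = "\<Sum>f\<in>F. prob (A f)" and ?V = "\<Sum>f\<in>F. \<Sum>g\<in>F. prob (A f \<inter> A g)"
  define N where "N x = (\<Sum>f\<in>F. indicat_real (A f) x)" for x
  have N2: "(N x)\<^sup>2 = (\<Sum>f\<in>F. \<Sum>g\<in>F. indicat_real (A f \<inter> A g) x)" for x
    by (simp add: N_def power2_eq_square sum_product indicator_inter_arith)
  have U: "(\<Union>f\<in>F. A f) \<in> events" using F A by auto
  have i1: "integrable M N" unfolding N_def using A by (auto simp: emeasure_eq_measure)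
  have i2: "integrable M (\<lambda>x. (N x)\<^sup>2)" unfolding N2 using A
    by (intro Bochner_Integration.integrable_sum integrable_real_indicator) (auto simp: emeasure_eq_measure)
  have e1: "expectation N = ?s" unfolding N_def using A
    by (subst Bochner_Integration.integral_sum) (auto simp: emeasure_eq_measure)
  have e2: "expectation (\<lambda>x. (N x)\<^sup>2) = ?V"
  proof -
    have "expectation (\<lambda>x. (N x)\<^sup>2) = (\<Sum>f\<in>F. \<Sum>g\<in>F. expectation (indicat_real (A f \<inter> A g)))"
      unfolding N2 using A
      by (subst Bochner_Integration.integral_sum, (auto simp: emeasure_eq_measure)[1])
         (intro sum.cong refl, subst Bochner_Integration.integral_sum, auto simp: emeasure_eq_measure)
    also have "\<dots> = ?V" using A by (intro sum.cong refl) (auto simp: Int_absorb1 sets.sets_into_space)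
    finally show ?thesis .
  qed
  have "2 / B * ?s - (1 / B)\<^sup>2 * ?V = expectation (\<lambda>x. 2 / B * N x - (1 / B)\<^sup>2 * (N x)\<^sup>2)"
    using i1 i2 by (simp add: e1 e2)
  also have "\<dots> \<le> expectation (indicat_real (\<Union>f\<in>F. A f))"
  proof (rule integral_mono)
    fix x
    have "0 \<le> (1 - N x / B)\<^sup>2" by simp
    then have "2 / B * N x - (1 / B)\<^sup>2 * (N x)\<^sup>2 \<le> 1" by (simp add: power2_eq_square algebra_simps)
    moreover have "N x = 0" if "x \<notin> (\<Union>f\<in>F. A f)"
      unfolding N_def using that by (intro sum.neutral) auto
    ultimately show "2 / B * N x - (1 / B)\<^sup>2 * (N x)\<^sup>2 \<le> indicat_real (\<Union>f\<in>F. A f) x"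
      by (cases "x \<in> (\<Union>f\<in>F. A f)") auto
  qed (use i1 i2 U in \<open>auto simp: emeasure_eq_measure\<close>)
  also have "\<dots> = prob (\<Union>f\<in>F. A f)" using U by (simp add: Int_absorb1 sets.sets_into_space)
  finally have "2 / B * ?s - (1 / B)\<^sup>2 * ?V \<le> prob (\<Union>f\<in>F. A f)" .
  moreover have "(1 / B)\<^sup>2 * ?V \<le> (1 / B)\<^sup>2 * (B * ?s)" by (intro mult_left_mono V) simp
  moreover have "(1 / B)\<^sup>2 * (B * ?s) = ?s / B" using B by (simp add: power2_eq_square field_simps)
  ultimately show ?thesis by simp
qed

section \<open>Uniformly random choice functions\<close>

lemma sum_PiE_insert:
  assumes "x \<notin> A"
  shows "(\<Sum>f\<in>PiE (insert x A) (\<lambda>_. B). F f) = (\<Sum>y\<in>B. \<Sum>g\<in>PiE A (\<lambda>_. B). F (g(x := y)))"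
  unfolding PiE_insert_eq
  by (subst sum.reindex[OF inj_combinator[OF assms]]) (simp add: sum.cartesian_product case_prod_unfold)

text \<open>A variance computation: under a uniformly random \<open>f\<close> the values
  \<open>u b (f b)\<close> are independent and centred, so only the squares survive. Sums replace
  expectations, hence the factor \<open>card B ^ card A\<close>, the number of choices.\<close>

lemma sum_PiE_square_le:
  fixes u :: "'b \<Rightarrow> 'c \<Rightarrow> real"
  assumes "finite A" "finite B" and "\<And>b. b \<in> A \<Longrightarrow> (\<Sum>i\<in>B. u b i) = 0"
    and "\<And>b i. b \<in> A \<Longrightarrow> i \<in> B \<Longrightarrow> \<bar>u b i\<bar> \<le> c"
  shows "(\<Sum>f\<in>PiE A (\<lambda>_. B). (\<Sum>b\<in>A. u b (f b))\<^sup>2) \<le> c\<^sup>2 * real (card A) * real (card B) ^ card A"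
  using assms
proof (induction A rule: finite_induct)
  case (insert x A)
  let ?P = "PiE A (\<lambda>_. B)" and ?s = "\<lambda>g. \<Sum>b\<in>A. u b (g b)"
  have IH: "(\<Sum>g\<in>?P. (?s g)\<^sup>2) \<le> c\<^sup>2 * real (card A) * real (card B) ^ card A"
    using insert by auto
  have cP: "real (card ?P) = real (card B) ^ card A" using insert by (simp add: card_PiE)
  have "(\<Sum>f\<in>PiE (insert x A) (\<lambda>_. B). (\<Sum>b\<in>insert x A. u b (f b))\<^sup>2)
     = (\<Sum>y\<in>B. \<Sum>g\<in>?P. (u x y + ?s g)\<^sup>2)"
  proof (subst sum_PiE_insert[OF insert(2)], intro sum.cong refl)
    fix y g
    have "(\<Sum>b\<in>A. u b ((g(x := y)) b)) = ?s g" using insert(2) by (intro sum.cong) auto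
    then show "(\<Sum>b\<in>insert x A. u b ((g(x := y)) b))\<^sup>2 = (u x y + ?s g)\<^sup>2"
      using insert(1,2) by simp
  qed
  also have "\<dots> = (\<Sum>y\<in>B. real (card ?P) * (u x y)\<^sup>2 + 2 * (\<Sum>g\<in>?P. ?s g) * u x y + (\<Sum>g\<in>?P. (?s g)\<^sup>2))"
    by (intro sum.cong refl) (simp add: power2_sum sum.distrib sum_distrib_left sum_distrib_right mult_ac)
  also have "\<dots> = real (card ?P) * (\<Sum>y\<in>B. (u x y)\<^sup>2) + 2 * (\<Sum>g\<in>?P. ?s g) * (\<Sum>y\<in>B. u x y) + real (card B) * (\<Sum>g\<in>?P. (?s g)\<^sup>2)"
    by (simp add: sum.distrib sum_distrib_left)
  \<comment> \<open>The cross term contains the sum of \<open>u x y\<close> over \<open>y\<close>,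
    which is 0.\<close>
  also have "\<dots> \<le> real (card B) ^ card A * (real (card B) * c\<^sup>2) + 0 + real (card B) * (c\<^sup>2 * real (card A) * real (card B) ^ card A)"
  proof (intro add_mono mult_left_mono IH)
    have "(\<Sum>y\<in>B. (u x y)\<^sup>2) \<le> (\<Sum>y\<in>B. c\<^sup>2)"
      using insert.prems(3)[of x] by (intro sum_mono) (metis abs_ge_zero insertI1 power2_abs power_mono)
    then show "real (card ?P) * (\<Sum>y\<in>B. (u x y)\<^sup>2) \<le> real (card B) ^ card A * (real (card B) * c\<^sup>2)"
      unfolding cP by (intro mult_left_mono) auto
  qed (use insert.prems in auto)
  also have "\<dots> = c\<^sup>2 * real (card (insert x A)) * real (card B) ^ card (insert x A)"
    using insert by (simp add: algebra_simps)
  finally show ?case .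
qed simp

text \<open>Chebyshev's inequality at twice the variance bound: at most half of the choices exceed
  it.\<close>

lemma card_PiE_concentrated:
  fixes u :: "'b \<Rightarrow> 'c \<Rightarrow> real"
  assumes fin: "finite A" "finite B" and "A \<noteq> {}" "c > 0" and "\<And>b. b \<in> A \<Longrightarrow> (\<Sum>i\<in>B. u b i) = 0"
    and "\<And>b i. b \<in> A \<Longrightarrow> i \<in> B \<Longrightarrow> \<bar>u b i\<bar> \<le> c"
  shows "real (card B) ^ card A / 2 \<le>
    real (card {f \<in> PiE A (\<lambda>_. B). (\<Sum>b\<in>A. u b (f b))\<^sup>2 \<le> 2 * c\<^sup>2 * real (card A)})"
proof -
  let ?P = "PiE A (\<lambda>_. B)" and ?s = "\<lambda>f. \<Sum>b\<in>A. u b (f b)" and ?L = "2 * c\<^sup>2 * real (card A)"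
  define G where "G = {f \<in> ?P. (?s f)\<^sup>2 \<le> ?L}"
  have fP: "finite ?P" using fin by (simp add: finite_PiE)
  have cA: "real (card A) > 0" using assms by (simp add: card_gt_0_iff)
  have "real (card (?P - G)) * ?L \<le> (\<Sum>f\<in>?P - G. (?s f)\<^sup>2)"
    unfolding sum_constant[symmetric] by (intro sum_mono) (auto simp: G_def)
  also have "\<dots> \<le> (\<Sum>f\<in>?P. (?s f)\<^sup>2)" by (intro sum_mono2 fP) auto
  also have "\<dots> \<le> c\<^sup>2 * real (card A) * real (card B) ^ card A" by (rule sum_PiE_square_le) (use assms in auto)
  finally have "(c\<^sup>2 * real (card A)) * (2 * real (card (?P - G))) \<le> (c\<^sup>2 * real (card A)) * real (card B) ^ card A"
    by (simp add: mult_ac)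
  then have "2 * real (card (?P - G)) \<le> real (card B) ^ card A"
    using cA \<open>c > 0\<close> by (simp add: mult_le_cancel_left_pos)
  moreover have "real (card (?P - G)) + real (card G) = real (card B) ^ card A"
  proof -
    have "card (?P - G) = card ?P - card G" and "card G \<le> card ?P"
      using fP by (auto simp: G_def intro!: card_Diff_subset card_mono)
    then have "card (?P - G) + card G = card B ^ card A" using fin by (simp add: card_PiE)
    then show ?thesis by (metis of_nat_add of_nat_power)
  qed
  ultimately show ?thesis unfolding G_def by simp
qed

text \<open>The distributive law; for random choices it says that the expectation of a product over
  blocks factors.\<close>

lemma sum_PiE_prod:
  fixes w :: "'b \<Rightarrow> 'c \<Rightarrow> real"
  assumes "finite A"
  shows "(\<Sum>g\<in>PiE A (\<lambda>_. B). \<Prod>b\<in>A. w b (g b)) = (\<Prod>b\<in>A. \<Sum>i\<in>B. w b i)"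
  using assms
proof (induction A rule: finite_induct)
  case (insert x A)
  have "(\<Prod>b\<in>A. w b ((g(x := y)) b)) = (\<Prod>b\<in>A. w b (g b))" for g y
    using insert(2) by (intro prod.cong) auto
  then show ?case using insert
    by (subst sum_PiE_insert) (simp_all add: sum_distrib_left[symmetric] sum_distrib_right[symmetric])
qed simp

text \<open>With \<open>m = card B\<close>, a uniformly random \<open>g\<close> agrees with
  \<open>f\<close> on each block independently with probability \<open>1 / m\<close>, so the
  exponential moment of the number of agreements is a power of \<open>1 + (e - 1) / m\<close>, which
  is at most \<open>exp (2 / m)\<close>.\<close>

lemma sum_exp_agreements_le:
  fixes f :: "'b \<Rightarrow> 'c"
  assumes A: "finite A" and B: "finite B" "B \<noteq> {}" and f: "f \<in> PiE A (\<lambda>_. B)"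
  shows "(\<Sum>g\<in>PiE A (\<lambda>_. B). exp (real (card {b \<in> A. f b = g b})))
     \<le> real (card B) ^ card A * exp (2 * real (card A) / real (card B))"
proof -
  define m where "m = real (card B)"
  have m: "m > 0" using B by (simp add: m_def card_gt_0_iff)
  have "(\<Sum>g\<in>PiE A (\<lambda>_. B). exp (real (card {b \<in> A. f b = g b})))
     = (\<Sum>g\<in>PiE A (\<lambda>_. B). \<Prod>b\<in>A. (if f b = g b then exp 1 else 1))"
  proof (intro sum.cong refl)
    fix g
    have "exp (real (card {b \<in> A. f b = g b})) = (\<Prod>b\<in>{b \<in> A. f b = g b}. exp (1::real))"
      by (simp add: exp_of_nat_mult[symmetric])
    also have "\<dots> = (\<Prod>b\<in>A. (if f b = g b then exp 1 else 1))"
      using A by (rule prod.inter_filter)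
    finally show "exp (real (card {b \<in> A. f b = g b})) = (\<Prod>b\<in>A. (if f b = g b then exp 1 else 1 :: real))" .
  qed
  also have "\<dots> = (\<Prod>b\<in>A. \<Sum>i\<in>B. (if f b = i then exp 1 else 1))" by (rule sum_PiE_prod[OF A])
  also have "\<dots> \<le> (\<Prod>b\<in>A. m * exp (2 / m))"
  proof (intro prod_mono conjI)
    fix b assume "b \<in> A"
    then have fb: "f b \<in> B" using f by auto
    \<comment> \<open>Exactly one \<open>i\<close> agrees with \<open>f b\<close>; it raises the
      count \<open>m\<close> by \<open>e - 1\<close>, at most 2.\<close>
    have "(\<Sum>i\<in>B. (if f b = i then exp 1 else 1 :: real)) = (\<Sum>i\<in>B. 1 + (if f b = i then exp 1 - 1 else 0))"
      by (intro sum.cong) auto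
    also have "\<dots> = m + (exp 1 - 1)" using fb B by (simp add: sum.distrib m_def)
    also have "\<dots> \<le> m + 2" using exp_le by simp
    also have "\<dots> = m * (1 + 2 / m)" using m by (simp add: field_simps)
    also have "\<dots> \<le> m * exp (2 / m)" using m by (intro mult_left_mono exp_ge_add_one_self) auto
    finally show "(\<Sum>i\<in>B. (if f b = i then exp 1 else 1)) \<le> m * exp (2 / m)" .
    show "0 \<le> (\<Sum>i\<in>B. (if f b = i then exp 1 else 1 :: real))" by (intro sum_nonneg) auto
  qed
  also have "\<dots> = m ^ card A * exp (2 * real (card A) / m)"
    by (simp add: power_mult_distrib exp_of_nat_mult[symmetric] mult_ac)
  finally show ?thesis unfolding m_def .
qed

section \<open>Comparison of Gaussian small ball probabilities\<close>

text \<open>\<open>small_ball e d q\<close> is the heuristic probability that a centred Gaussian vector in dimension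
  \<open>d\<close> with covariance \<open>q\<close> times the identity lies in a given box of half-width \<open>e\<close> near the origin.\<close>

definition small_ball :: "real \<Rightarrow> nat \<Rightarrow> real \<Rightarrow> real" where
  "small_ball e d q = (2 * e / sqrt (2 * pi * q)) ^ d"

lemma small_ball_pos: "e > 0 \<Longrightarrow> q > 0 \<Longrightarrow> small_ball e d q > 0"
  by (simp add: small_ball_def)

text \<open>In the variance the small ball behaves as the power \<open>- d / 2\<close>, so a
  variance ratio of \<open>exp (2 * t)\<close> costs the factor \<open>exp (d * t)\<close>.\<close>

lemma small_ball_le_exp:
  assumes q: "q > 0" "r > 0" and le: "q \<le> r * exp (2 * t)" and t: "real d * t \<le> s" and e: "e > 0"
  shows "small_ball e d r \<le> exp s * small_ball e d q"
proof -
  have "sqrt (2 * pi * q) \<le> sqrt (2 * pi * r * (exp t)\<^sup>2)"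
    using le unfolding exp_double[of t] mult.assoc by simp
  also have "\<dots> = sqrt (2 * pi * r) * exp t" by (simp add: real_sqrt_mult)
  finally have "2 * e / sqrt (2 * pi * r) \<le> 2 * e / sqrt (2 * pi * q) * exp t"
    using q e by (simp add: field_simps)
  then have "small_ball e d r \<le> (2 * e / sqrt (2 * pi * q) * exp t) ^ d"
    unfolding small_ball_def using q e by (intro power_mono) auto
  also have "\<dots> = small_ball e d q * exp (real d * t)"
    unfolding small_ball_def power_mult_distrib exp_of_nat_mult ..
  also have "\<dots> \<le> small_ball e d q * exp s" using t small_ball_pos[OF e q(1), of d] by simp
  finally show ?thesis by (simp add: mult.commute)
qed

context
  fixes d k :: nat and q :: real
  assumes d: "d > 0" and k: "real k \<ge> 10000 * (real d)\<^sup>2" and q: "q \<ge> real k"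
begin

lemma sqrt_k_ge: "sqrt (real k) \<ge> 100 * real d"
  by (rule real_le_rsqrt) (use k in \<open>simp add: power_mult_distrib\<close>)

lemma k_ge_d: "real k \<ge> 10000 * real d"
proof -
  have "real d * 1 \<le> real d * real d" using d by (intro mult_left_mono) auto
  then show ?thesis using k by (simp add: power2_eq_square)
qed

lemma k_ge: "real k \<ge> 10000"
  using k_ge_d d by simp

text \<open>\<open>sqrt (18 * k)\<close> is the deviation of the variance allowed to typical
  choices. The exponent \<open>d\<close> in \<open>small_ball\<close> magnifies its relative size by
  \<open>d\<close>, which \<open>k \<ge> 10000 * d\<^sup>2\<close> absorbs.\<close>

lemma sqrt_18_k_le: "real d * sqrt (18 * real k) \<le> real k / 20"
proof -
  have "sqrt 18 \<le> 5" by (rule real_le_lsqrt) auto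
  then have "real d * sqrt (18 * real k) \<le> real d * (5 * sqrt (real k))"
    by (intro mult_left_mono) (auto simp: real_sqrt_mult intro: mult_right_mono)
  also have "\<dots> \<le> sqrt (real k) / 100 * (5 * sqrt (real k))" using sqrt_k_ge by (intro mult_right_mono) auto
  finally show ?thesis by simp
qed

lemma sqrt_18_k_le': "sqrt (18 * real k) \<le> real k / 20"
proof -
  have "1 * sqrt (18 * real k) \<le> real d * sqrt (18 * real k)" using d by (intro mult_right_mono) auto
  with sqrt_18_k_le show ?thesis by simp
qed

lemma small_ball_fluctuation_ge:
  assumes "Q \<le> q + sqrt (18 * real k)" "Q > 0" "e > 0"
  shows "small_ball e d q \<le> exp 1 * small_ball e d Q"
proof (rule small_ball_le_exp[where t = "sqrt (18 * real k) / real k"])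
  have kp: "real k > 0" using k_ge by simp
  define w where "w = sqrt (18 * real k) / real k"
  have w: "w \<ge> 0" "real k * w = sqrt (18 * real k)" using kp by (auto simp: w_def)
  have "real k * w \<le> q * w" using q w by (intro mult_right_mono) auto
  moreover have "0 \<le> q * w" using q w kp by simp
  ultimately have "q + sqrt (18 * real k) \<le> q * (1 + 2 * (sqrt (18 * real k) / real k))"
    unfolding w(2)[symmetric] w_def[symmetric] by (simp add: distrib_left)
  also have "\<dots> \<le> q * exp (2 * (sqrt (18 * real k) / real k))" using q kp by (intro mult_left_mono exp_ge_add_one_self) auto
  finally show "Q \<le> q * exp (2 * (sqrt (18 * real k) / real k))" using assms by simp
  show "real d * (sqrt (18 * real k) / real k) \<le> 1" using sqrt_18_k_le kp by (simp add: field_simps)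
  show "q > 0" using q kp by simp
qed (use assms in auto)

text \<open>Each of \<open>J\<close> shared blocks removes variance at most 4. For a total loss
  \<open>x\<close> with \<open>2 * x \<le> q\<close> one has
  \<open>q \<le> (q - x) * (1 + 2 * x / q)\<close>, and the resulting exponent
  \<open>d * x / q\<close> is at most \<open>1 + J\<close> because
  \<open>4 * d \<le> k\<close>.\<close>

lemma small_ball_overlap_le:
  assumes r: "r \<ge> q - sqrt (18 * real k) - 4 * J" and J: "0 \<le> J" "J \<le> real k / 16" and "e > 0"
  shows "small_ball e d r \<le> exp (1 + J) * small_ball e d q"
proof -
  define x where "x = sqrt (18 * real k) + 4 * J"
  have kp: "real k > 0" using k_ge by simp
  \<comment> \<open>\<open>x\<close> is at most \<open>k / 20 + k / 4\<close>.\<close>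
  have x0: "x \<ge> 0" and xk: "2 * x \<le> real k" using J sqrt_18_k_le' kp by (auto simp: x_def)
  have qp: "q > 0" and xq: "2 * x \<le> q" using q kp xk by auto
  show ?thesis
  proof (rule small_ball_le_exp[where t = "x / q"])
    have "x * (2 * x) \<le> x * q" using xq x0 by (intro mult_left_mono)
    then have "q \<le> (q - x) * (1 + 2 * (x / q))" using qp by (simp add: field_simps)
    also have "\<dots> \<le> r * exp (2 * (x / q))"
      using r x0 xq qp by (intro mult_mono exp_ge_add_one_self) (auto simp: x_def)
    finally show "q \<le> r * exp (2 * (x / q))" .
    have "real d * (x / q) \<le> real d * (x / real k)" using q kp x0 by (intro mult_left_mono divide_left_mono) auto
    also have "\<dots> = real d * sqrt (18 * real k) / real k + 4 * real d / real k * J" by (simp add: x_def add_divide_distrib distrib_left)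
    also have "\<dots> \<le> 1 + 1 * J"
      using sqrt_18_k_le kp J k_ge_d by (intro add_mono mult_right_mono) (auto simp: field_simps)
    finally show "real d * (x / q) \<le> 1 + J" by simp
    show "r > 0" using r x0 xq qp kp unfolding x_def by argo
  qed (use assms qp in auto)
qed

text \<open>The logarithm of the reciprocal small ball is
  \<open>d * ln (sqrt (2 * pi * q) / (2 * e))\<close>, at most
  \<open>d * (2 + sqrt k + ln (1 / e))\<close>. The lower bounds on \<open>k\<close> make each of
  the three terms small against \<open>k\<close>.\<close>

lemma small_ball_ge_exp:
  assumes q4: "q \<le> 4 * real k" and e: "0 < e" and ke: "real k \<ge> 10000 * real d * ln (1 / e)"
  shows "1 \<le> small_ball e d q * exp (real k / 16)"
proof -
  have kp: "real k > 0" using k_ge by simp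
  have qp: "q > 0" using q kp by simp
  \<comment> \<open>With \<open>pi < 4\<close> the product is at most \<open>32 * k\<close>, rounded
    up to \<open>6\<^sup>2 * k\<close> to have a simple root.\<close>
  have "2 * pi * q \<le> 2 * 4 * (4 * real k)" using q4 qp pi_less_4 by (intro mult_mono) auto
  then have "sqrt (2 * pi * q) \<le> sqrt (6\<^sup>2 * real k)" using kp by simp
  then have "sqrt (2 * pi * q) \<le> 6 * sqrt (real k)" by (simp add: real_sqrt_mult)
  then have 1: "sqrt (2 * pi * q) / (2 * e) \<le> 3 * sqrt (real k) * (1 / e)" using e by (simp add: field_simps)
  have pos: "sqrt (2 * pi * q) / (2 * e) > 0" using qp e by simp
  have "ln (sqrt (2 * pi * q) / (2 * e)) \<le> ln (3 * sqrt (real k) * (1 / e))"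
    using 1 pos e kp by (subst ln_le_cancel_iff) auto
  also have "\<dots> = ln 3 + ln (sqrt (real k)) + ln (1 / e)" using e kp by (simp add: ln_mult ln_div)
  also have "\<dots> \<le> 2 + sqrt (real k) + ln (1 / e)"
    using ln_add_one_self_le_self[of 2] ln_bound[of "sqrt (real k)"] kp by simp
  finally have "real d * ln (sqrt (2 * pi * q) / (2 * e)) \<le> real d * (2 + sqrt (real k) + ln (1 / e))"
    by (intro mult_left_mono) auto
  also have "\<dots> = 2 * real d + real d * sqrt (real k) + real d * ln (1 / e)" by (simp add: algebra_simps)
  also have "\<dots> \<le> real k / 100 + real k / 100 + real k / 10000"
  proof (intro add_mono)
    have sk: "real d * sqrt (real k) \<le> sqrt (real k) / 100 * sqrt (real k)" using sqrt_k_ge by (intro mult_right_mono) auto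
    then show "real d * sqrt (real k) \<le> real k / 100" by simp
    have "2 \<le> sqrt (real k)" using k_ge by (intro real_le_rsqrt) auto
    then have "real d * 2 \<le> real d * sqrt (real k)" by (intro mult_left_mono) auto
    then show "2 * real d \<le> real k / 100" using sk by simp
  qed (use ke in simp)
  also have "\<dots> \<le> real k / 16" by simp
  finally have L: "real d * ln (sqrt (2 * pi * q) / (2 * e)) \<le> real k / 16" .
  have "1 = small_ball e d q * (sqrt (2 * pi * q) / (2 * e)) ^ d"
    using qp e by (simp add: small_ball_def power_mult_distrib[symmetric])
  also have "(sqrt (2 * pi * q) / (2 * e)) ^ d = exp (real d * ln (sqrt (2 * pi * q) / (2 * e)))"
    using pos by (simp add: exp_of_nat_mult)
  also have "small_ball e d q * \<dots> \<le> small_ball e d q * exp (real k / 16)"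
    using L small_ball_pos[OF e qp, of d] by simp
  finally show ?thesis .
qed

end

section \<open>Subset sums under fixed scales\<close>

text \<open>The event of interest with the scales frozen at \<open>a\<close>; only the
  \<open>d\<close> columns of coordinate Gaussians remain random.\<close>

definition subset_sum_event :: "nat \<Rightarrow> nat \<Rightarrow> nat \<Rightarrow> (nat \<Rightarrow> real) \<Rightarrow> (nat \<Rightarrow> real) \<Rightarrow> real \<Rightarrow> (nat \<times> nat \<Rightarrow> real) set" where
  "subset_sum_event n d k a z e =
     (\<Union>S\<in>{S. S \<subseteq> {..<n} \<and> card S = k}. box_event ({..<n} \<times> {..<d}) a S z d e)"

lemma sets_subset_sum_event:
  "subset_sum_event n d k a z e \<in> sets (gauss_space ({..<n} \<times> {..<d}))"
proof -
  have "finite {S. S \<subseteq> {..<n} \<and> card S = k}" by (rule finite_subset[of _ "Pow {..<n}"]) auto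
  then show ?thesis unfolding subset_sum_event_def
    by (intro sets.finite_UN sets_box_event) auto
qed

text \<open>\<open>h (b, i)\<close> is the \<open>i\<close>-th row of block \<open>b\<close>:
  injectivity makes the \<open>k\<close> blocks disjoint. How large \<open>n\<close> is compared
  with \<open>k\<close> is encoded in the block size \<open>m\<close>.\<close>

locale scaled_rows =
  fixes e :: real and d k n m :: nat and z a :: "nat \<Rightarrow> real" and h :: "nat \<times> nat \<Rightarrow> nat"
  assumes e: "0 < e" "e \<le> 1/4" and d: "d > 0" and m: "m > 0"
    and k: "real k \<ge> 10000 * (real d)\<^sup>2" and ke: "real k \<ge> 10000 * real d * ln (1 / e)"
    and z: "(\<Sum>j<d. \<bar>z j\<bar>) \<le> sqrt (real k)"
    and h: "inj_on h ({..<k} \<times> {..<m})" "h ` ({..<k} \<times> {..<m}) \<subseteq> {..<n}"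
    and a: "\<And>b i. b < k \<Longrightarrow> i < m \<Longrightarrow> 1 \<le> \<bar>a (h (b, i))\<bar> \<and> \<bar>a (h (b, i))\<bar> \<le> 2"
begin

definition choices :: "(nat \<Rightarrow> nat) set" where
  "choices = PiE {..<k} (\<lambda>_. {..<m})"

definition rows :: "(nat \<Rightarrow> nat) \<Rightarrow> nat set" where
  "rows f = (\<lambda>b. h (b, f b)) ` {..<k}"

text \<open>Given the scales, this is the variance of every coordinate of the sum over
  \<open>rows f\<close>.\<close>

definition var :: "(nat \<Rightarrow> nat) \<Rightarrow> real" where
  "var f = (\<Sum>b<k. (a (h (b, f b)))\<^sup>2)"

definition row_mean :: "nat \<Rightarrow> real" where
  "row_mean b = (\<Sum>i<m. (a (h (b, i)))\<^sup>2) / real m"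

text \<open>By linearity, the average of \<open>var\<close> over all of
  \<open>choices\<close>.\<close>

definition var_mean :: real where
  "var_mean = (\<Sum>b<k. row_mean b)"

definition typical :: "(nat \<Rightarrow> nat) set" where
  "typical = {f \<in> choices. (var f - var_mean)\<^sup>2 \<le> 18 * real k}"

definition hit :: "(nat \<Rightarrow> nat) \<Rightarrow> (nat \<times> nat \<Rightarrow> real) set" where
  "hit f = box_event ({..<n} \<times> {..<d}) a (rows f) z d e"

lemma k_ge_10000: "real k \<ge> 10000"
  by (rule k_ge[OF d k]) (rule order_refl)

lemma choices_less: "f \<in> choices \<Longrightarrow> b < k \<Longrightarrow> f b < m"
  by (auto simp: choices_def)

lemma finite_choices: "finite choices"
  by (simp add: choices_def finite_PiE)

lemma inj_on_row: "f \<in> choices \<Longrightarrow> inj_on (\<lambda>b. h (b, f b)) {..<k}"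
  using h(1) choices_less unfolding inj_on_def by blast

lemma scale_square: "b < k \<Longrightarrow> i < m \<Longrightarrow> 1 \<le> (a (h (b, i)))\<^sup>2 \<and> (a (h (b, i)))\<^sup>2 \<le> 4"
  using a[of b i] power_mono[of 1 "\<bar>a (h (b, i))\<bar>" 2] power_mono[of "\<bar>a (h (b, i))\<bar>" 2 2] by auto

lemma rows_subset: "f \<in> choices \<Longrightarrow> rows f \<subseteq> {..<n}"
  using h(2) choices_less by (fastforce simp: rows_def)

lemma card_rows: "f \<in> choices \<Longrightarrow> card (rows f) = k"
  using inj_on_row by (simp add: rows_def card_image)

lemma finite_rows: "finite (rows f)"
  by (simp add: rows_def)

lemma scale_nonzero: "f \<in> choices \<Longrightarrow> i \<in> rows f \<Longrightarrow> a i \<noteq> 0"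
  unfolding rows_def using a choices_less by force

lemma sum_rows: "f \<in> choices \<Longrightarrow> (\<Sum>i\<in>rows f. (a i)\<^sup>2) = var f"
  unfolding rows_def var_def by (subst sum.reindex[OF inj_on_row]) auto

text \<open>By injectivity of \<open>h\<close> different blocks never share a row, so
  \<open>f\<close> and \<open>g\<close> have a row in common exactly where they agree.\<close>

lemma rows_Diff:
  assumes f: "f \<in> choices" and g: "g \<in> choices"
  shows "rows g - rows f = (\<lambda>b. h (b, g b)) ` {b \<in> {..<k}. f b \<noteq> g b}"
proof -
  have "h (b, g b) = h (b', f b') \<longleftrightarrow> (b, g b) = (b', f b')" if "b < k" "b' < k" for b b'
    by (rule inj_on_eq_iff[OF h(1)]) (use that choices_less[OF f] choices_less[OF g] in auto)
  then have "h (b, g b) \<in> rows f \<longleftrightarrow> f b = g b" if "b < k" for b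
    using that unfolding rows_def by (auto simp: image_iff)
  then show ?thesis unfolding rows_def[of g] by auto
qed

lemma sum_rows_Diff_ge:
  assumes f: "f \<in> choices" and g: "g \<in> choices"
  shows "var g - 4 * real (card {b \<in> {..<k}. f b = g b}) \<le> (\<Sum>i\<in>rows g - rows f. (a i)\<^sup>2)"
proof -
  have inj: "inj_on (\<lambda>b. h (b, g b)) {b \<in> {..<k}. f b \<noteq> g b}"
    by (rule inj_on_subset[OF inj_on_row[OF g]]) auto
  have "(\<Sum>i\<in>rows g - rows f. (a i)\<^sup>2) = (\<Sum>b\<in>{b \<in> {..<k}. f b \<noteq> g b}. (a (h (b, g b)))\<^sup>2)"
    unfolding rows_Diff[OF f g] by (subst sum.reindex[OF inj]) simp
  moreover have "var g = (\<Sum>b\<in>{b \<in> {..<k}. f b \<noteq> g b}. (a (h (b, g b)))\<^sup>2) + (\<Sum>b\<in>{b \<in> {..<k}. f b = g b}. (a (h (b, g b)))\<^sup>2)"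
  proof -
    have "{..<k} \<inter> {b. f b \<noteq> g b} = {b \<in> {..<k}. f b \<noteq> g b}" "{..<k} - {b. f b \<noteq> g b} = {b \<in> {..<k}. f b = g b}"
      by auto
    then show ?thesis unfolding var_def by (subst sum.Int_Diff[of _ _ "{b. f b \<noteq> g b}"]) simp_all
  qed
  moreover have "(\<Sum>b\<in>{b \<in> {..<k}. f b = g b}. (a (h (b, g b)))\<^sup>2) \<le> (\<Sum>b\<in>{b \<in> {..<k}. f b = g b}. 4)"
    using scale_square choices_less[OF g] by (intro sum_mono) auto
  ultimately show ?thesis by simp
qed

lemma row_mean_bounds: "b < k \<Longrightarrow> 1 \<le> row_mean b \<and> row_mean b \<le> 4"
proof -
  assume b: "b < k"
  have "(\<Sum>i<m. 1) \<le> (\<Sum>i<m. (a (h (b, i)))\<^sup>2)" "(\<Sum>i<m. (a (h (b, i)))\<^sup>2) \<le> (\<Sum>i<m. 4)"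
    using scale_square[OF b] by (intro sum_mono; simp)+
  then show ?thesis using m by (simp add: row_mean_def field_simps)
qed

lemma var_mean_bounds: "real k \<le> var_mean" "var_mean \<le> 4 * real k"
  using sum_mono[of "{..<k}" "\<lambda>_. 1" row_mean] sum_mono[of "{..<k}" row_mean "\<lambda>_. 4"] row_mean_bounds
  by (auto simp: var_mean_def)

lemma var_ge: "f \<in> choices \<Longrightarrow> real k \<le> var f"
  using sum_mono[of "{..<k}" "\<lambda>_. 1" "\<lambda>b. (a (h (b, f b)))\<^sup>2"] scale_square choices_less
  by (auto simp: var_def)

lemma var_diff_le:
  assumes "f \<in> typical"
  shows "\<bar>var f - var_mean\<bar> \<le> sqrt (18 * real k)"
  using assms real_sqrt_le_mono[of "(var f - var_mean)\<^sup>2" "18 * real k"] by (simp add: typical_def)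

text \<open>Squared scales and their block means lie between 1 and 4, so they differ by at most 3;
  the threshold \<open>2 * 3\<^sup>2 * k\<close> is the source of \<open>18 * k\<close> in
  \<open>typical\<close>.\<close>

lemma card_typical: "real m ^ k / 2 \<le> real (card typical)"
proof -
  let ?u = "\<lambda>b i. (a (h (b, i)))\<^sup>2 - row_mean b"
  have "real (card {..<m}) ^ card {..<k} / 2 \<le>
    real (card {f \<in> PiE {..<k} (\<lambda>_. {..<m}). (\<Sum>b<k. ?u b (f b))\<^sup>2 \<le> 2 * 3\<^sup>2 * real (card {..<k})})"
  proof (rule card_PiE_concentrated)
    show "{..<k} \<noteq> {}" using k_ge_10000 by (auto simp: lessThan_empty_iff)
    show "(\<Sum>i\<in>{..<m}. ?u b i) = 0" for b using m by (simp add: sum_subtractf row_mean_def)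
    show "\<bar>?u b i\<bar> \<le> 3" if "b \<in> {..<k}" "i \<in> {..<m}" for b i
      using that scale_square[of b i] row_mean_bounds[of b] by auto
  qed auto
  then show ?thesis
    by (simp add: typical_def choices_def var_def var_mean_def sum_subtractf)
qed

lemma rows_nonempty: "f \<in> choices \<Longrightarrow> rows f \<noteq> {}"
  using card_rows k_ge_10000 by force

lemma rows_times_subset: "f \<in> choices \<Longrightarrow> rows f \<times> {..<d} \<subseteq> {..<n} \<times> {..<d}"
  using rows_subset by blast

abbreviation \<mu> :: "(nat \<times> nat \<Rightarrow> real) set \<Rightarrow> real" where
  "\<mu> \<equiv> measure (gauss_space ({..<n} \<times> {..<d}))"

text \<open>The bound on the 1-norm also bounds each \<open>\<bar>z j\<bar>\<close> by
  \<open>sqrt k\<close>, so the squares sum to at most \<open>k\<close>. The cross terms add at most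
  another \<open>k\<close>, and the terms \<open>e\<^sup>2\<close> at most
  \<open>d \<le> k\<close>.\<close>

lemma sum_center_le: "(\<Sum>j<d. (\<bar>z j\<bar> + e)\<^sup>2) \<le> 3 * real k"
proof -
  have "(\<Sum>j<d. (\<bar>z j\<bar> + e)\<^sup>2) \<le> (\<Sum>j<d. 2 * (\<bar>z j\<bar> * sqrt (real k)) + 1)"
  proof (rule sum_mono)
    fix j assume "j \<in> {..<d}"
    then have "\<bar>z j\<bar> \<le> (\<Sum>j<d. \<bar>z j\<bar>)" by (intro member_le_sum) auto
    then have zj: "\<bar>z j\<bar> \<le> sqrt (real k)" using z by simp
    have "(\<bar>z j\<bar> + e)\<^sup>2 = \<bar>z j\<bar> * \<bar>z j\<bar> + 2 * e * \<bar>z j\<bar> + e\<^sup>2" by (simp add: power2_eq_square algebra_simps)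
    also have "\<dots> \<le> \<bar>z j\<bar> * sqrt (real k) + 1 * \<bar>z j\<bar> + 1"
      using e zj by (intro add_mono mult_left_mono mult_right_mono power_le_one) auto
    also have "1 * \<bar>z j\<bar> \<le> \<bar>z j\<bar> * sqrt (real k)"
      using k_ge_10000 by (subst mult.commute, intro mult_left_mono) auto
    finally show "(\<bar>z j\<bar> + e)\<^sup>2 \<le> 2 * (\<bar>z j\<bar> * sqrt (real k)) + 1" by simp
  qed
  also have "\<dots> = 2 * ((\<Sum>j<d. \<bar>z j\<bar>) * sqrt (real k)) + real d"
    by (simp add: sum.distrib sum_distrib_left sum_distrib_right)
  also have "\<dots> \<le> 2 * (sqrt (real k) * sqrt (real k)) + real k"
    using k_ge_d[OF d k order_refl] z by (intro add_mono mult_left_mono mult_right_mono) auto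
  finally show ?thesis by simp
qed

text \<open>One factor \<open>exp (- 1)\<close> pays for replacing \<open>var_mean\<close> by
  \<open>var f\<close>. The Gaussian exponent is at most \<open>3 * k / (2 * var f)\<close>, below
  2, which pays the remaining \<open>exp (- 2)\<close>.\<close>

lemma hit_ge:
  assumes f: "f \<in> typical"
  shows "exp (- 3) * small_ball e d var_mean \<le> \<mu> (hit f)"
proof -
  have fc: "f \<in> choices" using f by (simp add: typical_def)
  have vp: "var f > 0" using var_ge[OF fc] k_ge_10000 by simp
  have "small_ball e d var_mean \<le> exp 1 * small_ball e d (var f)"
    by (rule small_ball_fluctuation_ge[OF d k]) (use var_diff_le[OF f] var_mean_bounds vp e in auto)
  then have "exp (- 3) * small_ball e d var_mean \<le> exp (- 3) * (exp 1 * small_ball e d (var f))"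
    by (intro mult_left_mono) auto
  also have "\<dots> = exp (- 2) * small_ball e d (var f)" by (simp add: mult.assoc[symmetric] exp_add[symmetric])
  also have "\<dots> \<le> small_ball e d (var f) * exp (- (\<Sum>j<d. (\<bar>z j\<bar> + e)\<^sup>2) / (2 * var f))"
  proof (subst mult.commute, intro mult_left_mono)
    have "(\<Sum>j<d. (\<bar>z j\<bar> + e)\<^sup>2) \<le> 2 * (2 * var f)" using sum_center_le var_ge[OF fc] by simp
    then show "exp (- 2) \<le> exp (- (\<Sum>j<d. (\<bar>z j\<bar> + e)\<^sup>2) / (2 * var f))" using vp by (simp add: field_simps)
  qed (use small_ball_pos[OF e(1) vp, of d] in simp)
  also have "\<dots> \<le> \<mu> (hit f)"
    unfolding hit_def small_ball_def sum_rows[OF fc, symmetric]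
    by (rule measure_box_event_ge) (use finite_rows rows_nonempty[OF fc] rows_times_subset[OF fc] d scale_nonzero[OF fc] e in auto)
  finally show ?thesis .
qed

lemma hit_Int_le:
  assumes f: "f \<in> typical" and g: "g \<in> typical"
  shows "\<mu> (hit f \<inter> hit g) \<le> \<mu> (hit f) * (small_ball e d var_mean * exp 1) * exp (real (card {b \<in> {..<k}. f b = g b}))"
proof -
  let ?J = "real (card {b \<in> {..<k}. f b = g b})" and ?p = "small_ball e d var_mean"
  interpret prob_space "gauss_space ({..<n} \<times> {..<d})" by (rule prob_space_gauss)
  have fc: "f \<in> choices" and gc: "g \<in> choices" using f g by (simp_all add: typical_def)
  have vm: "var_mean > 0" using var_mean_bounds k_ge_10000 by simp
  have hm: "hit f \<in> events" unfolding hit_def by (intro sets_box_event rows_times_subset fc)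
  show ?thesis
  proof (cases "?J \<le> real k / 16")
    case True
    let ?R = "\<Sum>i\<in>rows g - rows f. (a i)\<^sup>2"
    have R: "?R \<ge> var_mean - sqrt (18 * real k) - 4 * ?J"
      using sum_rows_Diff_ge[OF fc gc] var_diff_le[OF g] by simp
    \<comment> \<open>If \<open>rows f\<close> contained \<open>rows g\<close>, then
      \<open>var g \<le> 4 * ?J \<le> k / 4\<close>, against \<open>var g \<ge> k\<close>.\<close>
    have ne: "rows g - rows f \<noteq> {}"
    proof
      assume *: "rows g - rows f = {}"
      have "var g \<le> 4 * ?J" using sum_rows_Diff_ge[OF fc gc] unfolding * by simp
      then show False using True var_ge[OF gc] k_ge_10000 by simp
    qed
    have "\<mu> (hit f \<inter> hit g) \<le> \<mu> (hit f) * small_ball e d ?R"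
      unfolding hit_def small_ball_def
      by (rule measure_box_event_Int_le) (use finite_rows ne rows_times_subset fc gc d scale_nonzero e in auto)
    also have "\<dots> \<le> \<mu> (hit f) * (exp (1 + ?J) * ?p)"
      by (intro mult_left_mono small_ball_overlap_le[OF d k var_mean_bounds(1) R]) (use True e in auto)
    finally show ?thesis by (simp add: exp_add mult_ac)
  next
    case False
    \<comment> \<open>Little fresh randomness may be left in \<open>g\<close>, but the trivial bound
      suffices since \<open>?p * exp (k / 16)\<close> is at least 1.\<close>
    have "\<mu> (hit f \<inter> hit g) \<le> \<mu> (hit f) * 1" using hm by (auto intro: finite_measure_mono)
    also have "\<dots> \<le> \<mu> (hit f) * (?p * exp (real k / 16))"
      by (intro mult_left_mono small_ball_ge_exp[OF d k var_mean_bounds e(1) ke]) simp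
    also have "\<dots> \<le> \<mu> (hit f) * (?p * exp (1 + ?J))"
      using False small_ball_pos[OF e(1) vm, of d] by (intro mult_left_mono) auto
    finally show ?thesis by (simp add: exp_add mult_ac)
  qed
qed

text \<open>In the second moment method \<open>B\<close> is \<open>?p * exp 1 * W\<close>, with
  \<open>W\<close> a bound for the sum of \<open>exp (?J f g)\<close> over all choices
  \<open>g\<close>. The first moment is at least \<open>m ^ k / 2 * exp (- 3) * ?p\<close>, so
  \<open>?p\<close> and \<open>m ^ k\<close> cancel in the quotient.\<close>

lemma subset_sum_event_ge:
  "exp (- 4 - 2 * real k / real m) / 2 \<le> \<mu> (subset_sum_event n d k a z e)"
proof -
  interpret prob_space "gauss_space ({..<n} \<times> {..<d})" by (rule prob_space_gauss)
  let ?p = "small_ball e d var_mean" and ?J = "\<lambda>f g. real (card {b \<in> {..<k}. f b = g b})"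
  have vm: "var_mean > 0" using var_mean_bounds k_ge_10000 by simp
  have p: "?p > 0" by (rule small_ball_pos[OF e(1) vm])
  define W where "W = real m ^ k * exp (2 * real k / real m)"
  define B where "B = ?p * exp 1 * W"
  have B: "B > 0" using p m by (simp add: B_def W_def)
  have fin: "finite typical" using finite_choices by (simp add: typical_def)
  have ev: "hit f \<in> events" if "f \<in> typical" for f
    using that unfolding hit_def typical_def by (intro sets_box_event rows_times_subset) auto
  have "(\<Sum>f\<in>typical. \<Sum>g\<in>typical. prob (hit f \<inter> hit g)) \<le> (\<Sum>f\<in>typical. B * prob (hit f))"
  proof (rule sum_mono)
    fix f assume f: "f \<in> typical"
    have "(\<Sum>g\<in>typical. prob (hit f \<inter> hit g)) \<le> (\<Sum>g\<in>typical. prob (hit f) * (?p * exp 1) * exp (?J f g))"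
      by (intro sum_mono hit_Int_le f)
    \<comment> \<open>Enlarging \<open>typical\<close> to the full product set lets the exponential
      moment factor over blocks.\<close>
    also have "\<dots> \<le> (\<Sum>g\<in>choices. prob (hit f) * (?p * exp 1) * exp (?J f g))"
      using p by (intro sum_mono2 finite_choices) (auto simp: typical_def)
    also have "\<dots> = prob (hit f) * (?p * exp 1) * (\<Sum>g\<in>choices. exp (?J f g))" by (simp add: sum_distrib_left)
    also have "\<dots> \<le> prob (hit f) * (?p * exp 1) * W"
    proof (intro mult_left_mono)
      have "(\<Sum>g\<in>PiE {..<k} (\<lambda>_. {..<m}). exp (?J f g)) \<le> real (card {..<m}) ^ card {..<k} * exp (2 * real (card {..<k}) / real (card {..<m}))"
        by (rule sum_exp_agreements_le) (use m f in \<open>auto simp: typical_def choices_def\<close>)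
      then show "(\<Sum>g\<in>choices. exp (?J f g)) \<le> W" by (simp add: W_def choices_def)
    qed (use p in auto)
    finally show "(\<Sum>g\<in>typical. prob (hit f \<inter> hit g)) \<le> B * prob (hit f)" by (simp add: B_def mult_ac)
  qed
  then have sm: "(\<Sum>f\<in>typical. prob (hit f)) / B \<le> prob (\<Union>f\<in>typical. hit f)"
    by (intro second_moment_Union fin ev B) (simp_all add: sum_distrib_left)
  have "exp (- 4 - 2 * real k / real m) / 2 * B = real m ^ k / 2 * (exp (- 3) * ?p)"
  proof -
    have "exp (- 4 - 2 * real k / real m) * exp 1 * exp (2 * real k / real m) = exp (- 3 :: real)"
      by (simp add: exp_add[symmetric])
    then show ?thesis by (simp add: B_def W_def mult_ac)
  qed
  also have "\<dots> \<le> real (card typical) * (exp (- 3) * ?p)"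
    using card_typical p by (intro mult_right_mono) auto
  also have "\<dots> \<le> (\<Sum>f\<in>typical. prob (hit f))"
    using sum_mono[OF hit_ge] by simp
  finally have "exp (- 4 - 2 * real k / real m) / 2 \<le> (\<Sum>f\<in>typical. prob (hit f)) / B"
    using B by (simp add: pos_le_divide_eq)
  also note sm
  also have "prob (\<Union>f\<in>typical. hit f) \<le> prob (subset_sum_event n d k a z e)"
  proof (intro finite_measure_mono sets_subset_sum_event UN_least)
    fix f assume "f \<in> typical"
    then have "f \<in> choices" by (simp add: typical_def)
    then show "hit f \<subseteq> subset_sum_event n d k a z e"
      unfolding subset_sum_event_def hit_def using rows_subset card_rows by (intro UN_upper) simp
  qed
  finally show ?thesis .
qed

end

section \<open>Rows with scales of moderate size\<close>

definition good_prob :: real where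
  "good_prob = measure std_normal_measure {x. 1 \<le> \<bar>x\<bar> \<and> \<bar>x\<bar> \<le> 2}"

lemma good_set_borel: "{x::real. 1 \<le> \<bar>x\<bar> \<and> \<bar>x\<bar> \<le> 2} \<in> sets borel"
  by measurable

lemma good_prob_pos: "good_prob > 0"
proof -
  interpret prob_space std_normal_measure by (rule prob_space_std_normal)
  \<comment> \<open>The interval from 1 to 2 has centre \<open>3/2\<close> and half-width
    \<open>1/2\<close>.\<close>
  have "0 < 2 * (1/2) / sqrt (2 * pi * 1) * exp (- (\<bar>3/2\<bar> + 1/2)\<^sup>2 / (2 * 1) :: real)" by simp
  also have "\<dots> \<le> measure (density lborel (normal_density 0 (sqrt 1))) {3/2 - 1/2..3/2 + 1/2}"
    by (rule measure_normal_interval(2)) auto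
  also have "\<dots> = prob {1..2}" by (simp add: std_normal_measure_def)
  also have "\<dots> \<le> good_prob" unfolding good_prob_def
    by (rule finite_measure_mono) (use good_set_borel in auto)
  finally show ?thesis .
qed

definition good_rows :: "nat \<Rightarrow> nat \<Rightarrow> (nat \<times> nat \<Rightarrow> real) \<Rightarrow> nat set" where
  "good_rows n d x = {i \<in> {..<n}. 1 \<le> \<bar>x (i, d)\<bar> \<and> \<bar>x (i, d)\<bar> \<le> 2}"

text \<open>A reversed Markov inequality: the number \<open>N\<close> of good rows has mean
  \<open>n * good_prob\<close>, is at most \<open>n\<close> on \<open>E\<close>, and stays below
  half its mean off \<open>E\<close>.\<close>

lemma many_good_rows:
  fixes n d :: nat
  assumes n: "n > 0"
  defines "I \<equiv> {..<n} \<times> {d}"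
  defines "E \<equiv> {x \<in> space (gauss_space I). good_prob / 2 * real n \<le> real (card (good_rows n d x))}"
  shows "E \<in> sets (gauss_space I)" and "good_prob / 2 \<le> measure (gauss_space I) E"
proof -
  interpret prob_space "gauss_space I" by (rule prob_space_gauss)
  define G where "G i = {x \<in> space (gauss_space I). x (i, d) \<in> {x. 1 \<le> \<bar>x\<bar> \<and> \<bar>x\<bar> \<le> 2}}" for i
  define N where "N x = (\<Sum>i<n. indicat_real (G i) x)" for x
  have coord: "(\<lambda>x. x (i, d)) \<in> borel_measurable (gauss_space I)" if "i < n" for i
    by (rule measurable_gauss_coord) (use that in \<open>auto simp: I_def\<close>)
  have G: "G i \<in> events" if "i < n" for i
  proof -
    have "G i = (\<lambda>x. x (i, d)) -` {x. 1 \<le> \<bar>x\<bar> \<and> \<bar>x\<bar> \<le> 2} \<inter> space (gauss_space I)"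
      unfolding G_def by blast
    also have "\<dots> \<in> events" by (rule measurable_sets[OF coord[OF that] good_set_borel])
    finally show ?thesis .
  qed
  have PG: "prob (G i) = good_prob" if "i < n" for i
  proof -
    have p: "(i, d) \<in> I" using that by (simp add: I_def)
    have "good_prob = measure (distr (gauss_space I) std_normal_measure (\<lambda>x. x (i, d))) {x. 1 \<le> \<bar>x\<bar> \<and> \<bar>x\<bar> \<le> 2}"
      unfolding good_prob_def distr_PiM_component[OF prob_space_std_normal p] ..
    also have "\<dots> = prob (G i)"
      by (subst measure_distr) (use p good_set_borel in \<open>auto simp: G_def intro!: arg_cong[where f=prob]\<close>)
    finally show ?thesis ..
  qed
  have card: "real (card (good_rows n d x)) = N x" if "x \<in> space (gauss_space I)" for x
  proof -
    have "N x = (\<Sum>i<n. if x \<in> G i then 1 else 0)"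
      unfolding N_def by (intro sum.cong) (auto simp: indicator_def)
    also have "\<dots> = (\<Sum>i\<in>{i \<in> {..<n}. x \<in> G i}. 1)"
      by (rule sum.inter_filter[symmetric]) simp
    also have "{i \<in> {..<n}. x \<in> G i} = good_rows n d x" using that by (auto simp: G_def good_rows_def)
    finally show ?thesis by simp
  qed
  have Nm: "N \<in> borel_measurable (gauss_space I)"
    unfolding N_def using G by (intro borel_measurable_sum borel_measurable_indicator) auto
  have E_eq: "E = {x \<in> space (gauss_space I). good_prob / 2 * real n \<le> N x}"
    using card unfolding E_def by auto
  show E: "E \<in> events"
    unfolding E_eq by (intro borel_measurable_le Nm borel_measurable_const)
  have int: "integrable (gauss_space I) N"
    unfolding N_def using G by (intro Bochner_Integration.integrable_sum integrable_real_indicator) (auto simp: emeasure_eq_measure)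
  have "real n * good_prob = expectation N"
    unfolding N_def using G PG
    by (subst Bochner_Integration.integral_sum) (auto simp: emeasure_eq_measure Int_absorb1 sets.sets_into_space)
  also have "\<dots> \<le> expectation (\<lambda>x. real n * indicator E x + good_prob / 2 * real n)"
  proof (rule integral_mono[OF int])
    show "integrable (gauss_space I) (\<lambda>x. real n * indicator E x + good_prob / 2 * real n)"
      using E by (auto simp: emeasure_eq_measure)
    fix x assume x: "x \<in> space (gauss_space I)"
    have "N x \<le> (\<Sum>i<n. 1)" unfolding N_def by (intro sum_mono) (auto simp: indicator_def)
    then have "N x \<le> real n" by simp
    moreover have "0 \<le> good_prob / 2 * real n" using good_prob_pos by simp
    ultimately show "N x \<le> real n * indicator E x + good_prob / 2 * real n"
      using x unfolding E_eq by (simp add: indicator_def)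
  qed
  also have "\<dots> = real n * prob E + good_prob / 2 * real n"
    using E by (simp add: emeasure_eq_measure prob_space Int_absorb1 sets.sets_into_space)
  finally have "real n * (good_prob / 2) \<le> real n * prob E" by (simp add: algebra_simps)
  then show "good_prob / 2 \<le> prob E" using n by simp
qed

text \<open>Splitting the good rows into \<open>k\<close> blocks allows a block size proportional to
  \<open>n / k\<close>, hence at least to \<open>k\<close>, so \<open>2 * k / m\<close> is bounded
  by a constant.\<close>

lemma subset_sum_event_good_ge:
  fixes a :: "nat \<Rightarrow> real"
  assumes e: "0 < e" "e \<le> 1/4" and d: "d > 0" and nk: "n \<ge> k\<^sup>2"
    and k: "real k \<ge> 10000 * (real d)\<^sup>2" and ke: "real k \<ge> 10000 * real d * ln (1 / e)"
    and kg: "real k \<ge> 4 / good_prob"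
    and z: "(\<Sum>j<d. \<bar>z j\<bar>) \<le> sqrt (real k)"
    and good: "good_prob / 2 * real n \<le> real (card {i \<in> {..<n}. 1 \<le> \<bar>a i\<bar> \<and> \<bar>a i\<bar> \<le> 2})"
  shows "exp (- 4 - 8 / good_prob) / 2 \<le>
    measure (gauss_space ({..<n} \<times> {..<d})) (subset_sum_event n d k a z e)"
proof -
  let ?G = "{i \<in> {..<n}. 1 \<le> \<bar>a i\<bar> \<and> \<bar>a i\<bar> \<le> 2}"
  note p = good_prob_pos
  have kp: "real k > 0" using k_ge[OF d k order_refl] by simp
  define y where "y = good_prob / 2 * real n / real k"
  define m where "m = nat \<lfloor>y\<rfloor>"
  have y0: "y \<ge> 0" using p by (simp add: y_def)
  have my: "real m \<le> y" "y - 1 < real m" using y0 unfolding m_def by linarith+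
  have "real k * real k \<le> real n"
    using nk by (metis of_nat_le_iff of_nat_mult power2_eq_square)
  then have "good_prob / 2 * (real k * real k) \<le> good_prob / 2 * real n" using p by (intro mult_left_mono) auto
  then have yk: "good_prob / 2 * real k \<le> y" unfolding y_def using kp by (simp add: pos_le_divide_eq mult.assoc)
  have "4 \<le> good_prob * real k" using kg p by (simp add: pos_divide_le_eq mult.commute)
  \<comment> \<open>Rounding \<open>y\<close> down costs less than 1, at most half of
    \<open>good_prob * k / 2\<close> by \<open>kg\<close>.\<close>
  then have mk: "good_prob * real k / 4 \<le> real m" using my yk by linarith
  then have mp: "real m > 0" using p kp by (smt (verit) divide_pos_pos mult_pos_pos)
  have "real (k * m) \<le> real k * y" using my by (simp add: mult_left_mono)
  also have "\<dots> = good_prob / 2 * real n" using kp by (simp add: y_def)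
  also note good
  finally have "card ({..<k} \<times> {..<m}) \<le> card ?G"
    by (simp only: of_nat_le_iff card_cartesian_product card_lessThan)
  \<comment> \<open>Any injection into the good rows serves as an arrangement into blocks.\<close>
  then obtain h where h: "inj_on h ({..<k} \<times> {..<m})" "h ` ({..<k} \<times> {..<m}) \<subseteq> ?G"
    using inj_on_iff_card_le[of "{..<k} \<times> {..<m}" ?G] by auto
  interpret scaled_rows e d k n m z a h
  proof
    fix b i assume "b < k" "i < m"
    then have "h (b, i) \<in> ?G" using h(2) by blast
    then show "1 \<le> \<bar>a (h (b, i))\<bar> \<and> \<bar>a (h (b, i))\<bar> \<le> 2" by simp
  qed (use e d mp k ke z h in auto)
  have "2 * real k / real m \<le> 8 / good_prob" using mk mp p by (simp add: field_simps)
  then have "exp (- 4 - 8 / good_prob) / 2 \<le> exp (- 4 - 2 * real k / real m) / 2" by simp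
  also note subset_sum_event_ge
  finally show ?thesis .
qed

section \<open>Integration over the random scales and choice of constants\<close>

lemma sets_nsn_event:
  "{\<omega> \<in> space (nsn_space n d). \<exists>S \<subseteq> {..<n}. card S = k \<and>
      (\<forall>j<d. \<bar>(\<Sum>i\<in>S. nsn_vec d \<omega> i j) - z j\<bar> \<le> e)} \<in> sets (nsn_space n d)"
proof -
  let ?T = "{S. S \<subseteq> {..<n} \<and> card S = k}"
  have fT: "finite ?T" by (rule finite_subset[of _ "Pow {..<n}"]) auto
  have "{\<omega> \<in> space (nsn_space n d). \<forall>j\<in>{..<d}. \<bar>(\<Sum>i\<in>S. nsn_vec d \<omega> i j) - z j\<bar> \<le> e} \<in> sets (nsn_space n d)"
    if S: "S \<subseteq> {..<n}" for S
  proof (intro sets.sets_Collect_finite_All finite_lessThan borel_measurable_le borel_measurable_abs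
      borel_measurable_diff borel_measurable_const borel_measurable_sum)
    fix i j assume "i \<in> S" "j \<in> {..<d}"
    with S show "(\<lambda>\<omega>. nsn_vec d \<omega> i j) \<in> borel_measurable (nsn_space n d)"
      unfolding nsn_vec_def nsn_space_def by (intro borel_measurable_times measurable_gauss_coord) auto
  qed
  then have "{\<omega> \<in> space (nsn_space n d). \<exists>S\<in>?T. \<forall>j\<in>{..<d}. \<bar>(\<Sum>i\<in>S. nsn_vec d \<omega> i j) - z j\<bar> \<le> e} \<in> sets (nsn_space n d)"
    by (intro sets.sets_Collect_finite_Ex fT) (simp only: mem_Collect_eq)
  also have "{\<omega> \<in> space (nsn_space n d). \<exists>S\<in>?T. \<forall>j\<in>{..<d}. \<bar>(\<Sum>i\<in>S. nsn_vec d \<omega> i j) - z j\<bar> \<le> e}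
    = {\<omega> \<in> space (nsn_space n d). \<exists>S \<subseteq> {..<n}. card S = k \<and>
      (\<forall>j<d. \<bar>(\<Sum>i\<in>S. nsn_vec d \<omega> i j) - z j\<bar> \<le> e)}"
    by (intro Collect_cong) blast
  finally show ?thesis .
qed

text \<open>Fubini over the scales: for scales in \<open>E\<close> the section of the event contains
  \<open>subset_sum_event\<close>, whose probability has a constant lower bound, and
  \<open>E\<close> has probability at least \<open>good_prob / 2\<close>.\<close>

lemma nsn_event_ge:
  assumes e: "0 < e" "e \<le> 1/4" and d: "d > 0" and n: "n > 0" and nk: "n \<ge> k\<^sup>2"
    and k: "real k \<ge> 10000 * (real d)\<^sup>2" and ke: "real k \<ge> 10000 * real d * ln (1 / e)"
    and kg: "real k \<ge> 4 / good_prob"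
    and z: "(\<Sum>j<d. \<bar>z j\<bar>) \<le> sqrt (real k)"
  shows "good_prob / 2 * (exp (- 4 - 8 / good_prob) / 2) \<le> measure (nsn_space n d)
             {\<omega> \<in> space (nsn_space n d). \<exists>S \<subseteq> {..<n}. card S = k \<and>
                (\<forall>j<d. \<bar>(\<Sum>i\<in>S. nsn_vec d \<omega> i j) - z j\<bar> \<le> e)}" (is "_ \<le> measure _ ?T")
proof -
  \<comment> \<open>\<open>I\<close> indexes the scales, kept in column \<open>d\<close>, and
    \<open>K\<close> the other Gaussians.\<close>
  define I where "I = {..<n} \<times> {d}"
  define K where "K = {..<n} \<times> {..<d}"
  define E where "E = {x \<in> space (gauss_space I). good_prob / 2 * real n \<le> real (card (good_rows n d x))}"
  let ?c = "exp (- 4 - 8 / good_prob) / 2"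
  interpret product_sigma_finite "\<lambda>_::nat \<times> nat. std_normal_measure"
    using prob_space_std_normal by (simp add: prob_space_imp_sigma_finite product_sigma_finite.intro)
  interpret I: prob_space "gauss_space I" by (rule prob_space_gauss)
  interpret K: prob_space "gauss_space K" by (rule prob_space_gauss)
  interpret T: prob_space "nsn_space n d" unfolding nsn_space_def by (rule prob_space_gauss)
  have disj: "I \<inter> K = {}" and fin: "finite I" "finite K" by (auto simp: I_def K_def)
  have IK: "nsn_space n d = gauss_space (I \<union> K)"
    unfolding nsn_space_def by (rule arg_cong[where f=gauss_space]) (auto simp: I_def K_def)
  have T: "?T \<in> sets (gauss_space (I \<union> K))" using sets_nsn_event[of n d k z e] unfolding IK .
  note E = many_good_rows[OF n, of d, folded I_def, folded E_def]
  have "ennreal (?c * (good_prob / 2)) \<le> ennreal (?c * I.prob E)"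
    by (intro ennreal_leI mult_left_mono E(2)) simp
  also have "\<dots> = (\<integral>\<^sup>+x. ennreal ?c * indicator E x \<partial>gauss_space I)"
    unfolding nn_integral_cmult_indicator[OF E(1)] I.emeasure_eq_measure
    by (rule ennreal_mult) simp_all
  also have "\<dots> \<le> (\<integral>\<^sup>+x. emeasure (gauss_space K) ((\<lambda>y. merge I K (x, y)) -` ?T \<inter> space (gauss_space K)) \<partial>gauss_space I)"
  proof (intro nn_integral_mono)
    fix x assume x: "x \<in> space (gauss_space I)"
    show "ennreal ?c * indicator E x \<le> emeasure (gauss_space K) ((\<lambda>y. merge I K (x, y)) -` ?T \<inter> space (gauss_space K))"
    proof (cases "x \<in> E")
      case True
      let ?a = "\<lambda>i. x (i, d)"
      have eq: "nsn_vec d (merge I K (x, y)) i j = ?a i * y (i, j)" if "i < n" "j < d" for i j y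
        using that by (simp add: nsn_vec_def merge_def I_def K_def)
      have eq': "(\<Sum>i\<in>S. nsn_vec d (merge I K (x, y)) i j) = (\<Sum>i\<in>S. ?a i * y (i, j))" if "S \<subseteq> {..<n}" "j < d" for S j y
        using that by (intro sum.cong eq) auto
      have sp: "merge I K (x, y) \<in> space (nsn_space n d)" if "y \<in> space (gauss_space K)" for y
        using x that unfolding IK by (auto simp: space_PiM)
      have "subset_sum_event n d k ?a z e \<subseteq> (\<lambda>y. merge I K (x, y)) -` ?T \<inter> space (gauss_space K)"
      proof
        fix y assume "y \<in> subset_sum_event n d k ?a z e"
        then obtain S where S: "S \<subseteq> {..<n}" "card S = k" and y: "y \<in> space (gauss_space K)"
          and b: "\<forall>j<d. \<bar>(\<Sum>i\<in>S. ?a i * y (i, j)) - z j\<bar> \<le> e"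
          by (auto simp: subset_sum_event_def box_event_def K_def)
        have "\<forall>j<d. \<bar>(\<Sum>i\<in>S. nsn_vec d (merge I K (x, y)) i j) - z j\<bar> \<le> e"
          using b eq'[OF S(1)] by simp
        then show "y \<in> (\<lambda>y. merge I K (x, y)) -` ?T \<inter> space (gauss_space K)"
          using S y sp by blast
      qed
      moreover have "(\<lambda>y. merge I K (x, y)) -` ?T \<inter> space (gauss_space K) \<in> sets (gauss_space K)"
        using measurable_sets[OF measurable_comp[OF measurable_Pair1'[OF x] measurable_merge] T]
        by (simp only: comp_def)
      ultimately have "measure (gauss_space K) (subset_sum_event n d k ?a z e)
          \<le> K.prob ((\<lambda>y. merge I K (x, y)) -` ?T \<inter> space (gauss_space K))"
        by (rule K.finite_measure_mono)
      moreover have "?c \<le> measure (gauss_space K) (subset_sum_event n d k ?a z e)"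
        unfolding K_def
        by (rule subset_sum_event_good_ge[OF e d nk k ke kg z]) (use True in \<open>simp add: E_def good_rows_def\<close>)
      ultimately show ?thesis using True by (simp add: K.emeasure_eq_measure ennreal_leI)
    qed simp
  qed
  also have "\<dots> = emeasure (nsn_space n d) ?T"
    unfolding IK by (rule emeasure_fold_integral[OF disj fin, symmetric]) (use T in \<open>simp only: IK\<close>)
  also have "\<dots> = ennreal (T.prob ?T)" by (rule T.emeasure_eq_measure)
  finally show ?thesis by (subst (asm) ennreal_le_iff) (simp_all add: mult.commute)
qed

theorem theorem3:
  shows "\<exists>C::real. \<exists>c::real. C > 0 \<and> c > 0 \<and>
    (\<forall>(\<epsilon>::real) (d::nat) (k::nat) (n::nat) (z::nat \<Rightarrow> real).
       0 < \<epsilon> \<and> \<epsilon> \<le> 1/4 \<and> d > 0 \<and> k > 0 \<and> n > 0 \<and>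
       n \<ge> k^2 \<and> real k \<ge> C * real d ^ 3 * ln (real d / \<epsilon>) \<and>
       (\<Sum>j<d. \<bar>z j\<bar>) \<le> sqrt (real k)
       \<longrightarrow> measure (nsn_space n d)
             {\<omega> \<in> space (nsn_space n d). \<exists>S \<subseteq> {..<n}. card S = k \<and>
                (\<forall>j<d. \<bar>(\<Sum>i\<in>S. nsn_vec d \<omega> i j) - z j\<bar> \<le> \<epsilon>)} \<ge> c)"
proof (intro exI conjI allI impI)
  \<comment> \<open>The sum dominates both \<open>10000\<close> and \<open>4 / good_prob\<close>,
    the coefficients in the three lower bounds required of \<open>k\<close>.\<close>
  let ?C = "10000 + 4 / good_prob"
  show "?C > 0" using good_prob_pos by (simp add: add_pos_pos)
  show "good_prob / 2 * (exp (- 4 - 8 / good_prob) / 2) > 0" using good_prob_pos by simp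
  fix \<epsilon> :: real and d k n :: nat and z :: "nat \<Rightarrow> real"
  assume H: "0 < \<epsilon> \<and> \<epsilon> \<le> 1/4 \<and> d > 0 \<and> k > 0 \<and> n > 0 \<and>
       n \<ge> k^2 \<and> real k \<ge> ?C * real d ^ 3 * ln (real d / \<epsilon>) \<and>
       (\<Sum>j<d. \<bar>z j\<bar>) \<le> sqrt (real k)"
  then have e: "0 < \<epsilon>" "\<epsilon> \<le> 1/4" and d: "d > 0" "real d \<ge> 1" and n: "n > 0" "n \<ge> k\<^sup>2"
    and k: "?C * real d ^ 3 * ln (real d / \<epsilon>) \<le> real k" and z: "(\<Sum>j<d. \<bar>z j\<bar>) \<le> sqrt (real k)"
    by auto
  have C: "10000 \<le> ?C" "4 / good_prob \<le> ?C" using good_prob_pos by auto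
  \<comment> \<open>The logarithm is at least 1 because
    \<open>e \<le> 3 \<le> 1 / \<epsilon>\<close>, so bounds on \<open>k\<close> without a logarithm
    follow as well.\<close>
  have "3 \<le> 1 / \<epsilon>" using e by (simp add: field_simps)
  then have "exp 1 \<le> 1 / \<epsilon>" using exp_le by linarith
  then have l1: "1 \<le> ln (1 / \<epsilon>)" using e by (simp add: ln_ge_iff)
  have l2: "ln (1 / \<epsilon>) \<le> ln (real d / \<epsilon>)" using e d by (subst ln_le_cancel_iff) (auto intro: divide_right_mono)
  \<comment> \<open>Every lower bound required of \<open>k\<close> has the form
    \<open>A * d ^ i * L\<close>, with \<open>L\<close> either 1 or
    \<open>ln (1 / \<epsilon>)\<close>.\<close>
  have key: "A * real d ^ i * L \<le> real k"
    if "0 \<le> A" "A \<le> ?C" "i \<le> 3" "0 \<le> L" "L \<le> ln (real d / \<epsilon>)" for A L i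
  proof -
    have "A * real d ^ i * L \<le> ?C * real d ^ 3 * ln (real d / \<epsilon>)"
      using that d by (intro mult_mono power_increasing) auto
    then show ?thesis using k by simp
  qed
  show "good_prob / 2 * (exp (- 4 - 8 / good_prob) / 2) \<le> measure (nsn_space n d)
             {\<omega> \<in> space (nsn_space n d). \<exists>S \<subseteq> {..<n}. card S = k \<and>
                (\<forall>j<d. \<bar>(\<Sum>i\<in>S. nsn_vec d \<omega> i j) - z j\<bar> \<le> \<epsilon>)}"
  proof (rule nsn_event_ge[OF e d(1) n _ _ _ z])
    show "10000 * (real d)\<^sup>2 \<le> real k" using key[of 10000 2 1] C l1 l2 by simp
    show "10000 * real d * ln (1 / \<epsilon>) \<le> real k" using key[of 10000 1 "ln (1 / \<epsilon>)"] C l1 l2 by simp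
    show "4 / good_prob \<le> real k" using key[of "4 / good_prob" 0 1] C l1 l2 good_prob_pos by simp
  qed
qed

end
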